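(* There is a universal constant $c>0$ such that for every $N\ge 1$ and every nonempty finite set $T\subseteq\mathbb{R}^N$, with $d$ the Euclidean distance on $T$, $$c\,\mathcal{M}(T,d)\le \mathcal{Z}(T,d),$$ where $$\mathcal{M}(T,d)=\inf_{\mu\in\mathcal{P}(T)}\sup_{t\in T}\int_0^{\mathrm{diam}(T)}\sqrt{\log\frac{1}{\mu(B(t,r))}}\,dr$$ is the Fernique--Talagrand functional and $$\mathcal{Z}(T,d)=\sup_{\pi\in\mathcal{P}(T)}\int_0^\infty \mathrm{MMSE}_\pi(s)\,ds$$ is the integrated Bayes-risk functional.
   Context: $\mathcal{P}(T)$ is the set of probability measures on $T$; $\mathrm{diam}(T)=\max_{x,y\in T}d(x,y)$; $B(t,r)=\{u\in T: d(t,u)\le r\}$; and $\log(1/0)=+\infty$. For $\pi\in\mathcal{P}(T)$ and $s\ge 0$, let $X\sim\pi$ and $Z\sim N(0,I_N)$ be independent and let $Y_s=sX+Z$. The minimum mean-squared error is $$\mathrm{MMSE}_\pi(s)=\mathbb{E}\bigl\|X-\mathbb{E}[X\mid Y_s]\bigr\|_2^2 .$$ *)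

theory Defs
  imports "HOL-Probability.Probability"
begin

(* The dimension N is quantified inside the main statement (the constant does not depend on it),
   so R^N is the carrier of functions {..<N} -> R, extended by undefined outside {..<N}. *)
definition RN :: "nat \<Rightarrow> (nat \<Rightarrow> real) set" where
  "RN N = (\<Pi>\<^sub>E i\<in>{..<N}. UNIV)"

definition euc_dist :: "nat \<Rightarrow> (nat \<Rightarrow> real) \<Rightarrow> (nat \<Rightarrow> real) \<Rightarrow> real" where
  "euc_dist N x y = L2_set (\<lambda>i. x i - y i) {..<N}"

(* Only used for finite T, where every probability measure on T is a pmf. *)
definition prob_on :: "'a set \<Rightarrow> 'a pmf set" where
  "prob_on T = {p. set_pmf p \<subseteq> T}"

definition diam :: "'a set \<Rightarrow> ('a \<Rightarrow> 'a \<Rightarrow> real) \<Rightarrow> real" where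
  "diam T d = Max {d x y | x y. x \<in> T \<and> y \<in> T}"

definition closed_ball :: "'a set \<Rightarrow> ('a \<Rightarrow> 'a \<Rightarrow> real) \<Rightarrow> 'a \<Rightarrow> real \<Rightarrow> 'a set" where
  "closed_ball T d t r = {u \<in> T. d t u \<le> r}"

(* sqrt (log (1/m)) with the convention log (1/0) = infinity; used for 0 <= m <= 1. *)
definition sqrt_log_inv :: "real \<Rightarrow> ennreal" where
  "sqrt_log_inv m = (if m = 0 then \<infinity> else ennreal (sqrt (ln (1 / m))))"

definition fernique_talagrand :: "'a set \<Rightarrow> ('a \<Rightarrow> 'a \<Rightarrow> real) \<Rightarrow> ennreal" where
  "fernique_talagrand T d =
     (INF \<mu>\<in>prob_on T. SUP t\<in>T.
        \<integral>\<^sup>+ r\<in>{0..diam T d}. sqrt_log_inv (measure_pmf.prob \<mu> (closed_ball T d t r)) \<partial>lborel)"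

definition std_gaussian :: "nat \<Rightarrow> (nat \<Rightarrow> real) measure" where
  "std_gaussian N = (\<Pi>\<^sub>M i\<in>{..<N}. density lborel std_normal_density)"

(* Joint law of the independent pair (X, Z), X ~ p and Z ~ N(0, I_N): below X = fst, Z = snd. *)
definition XZ_space :: "nat \<Rightarrow> (nat \<Rightarrow> real) pmf \<Rightarrow> ((nat \<Rightarrow> real) \<times> (nat \<Rightarrow> real)) measure" where
  "XZ_space N p = measure_pmf p \<Otimes>\<^sub>M std_gaussian N"

definition observation :: "nat \<Rightarrow> real \<Rightarrow> (nat \<Rightarrow> real) \<times> (nat \<Rightarrow> real) \<Rightarrow> (nat \<Rightarrow> real)" where
  "observation N s = (\<lambda>(x, z). \<lambda>i\<in>{..<N}. s * x i + z i)"

definition sigma_obs ::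
  "nat \<Rightarrow> (nat \<Rightarrow> real) pmf \<Rightarrow> real \<Rightarrow> ((nat \<Rightarrow> real) \<times> (nat \<Rightarrow> real)) measure" where
  "sigma_obs N p s =
     vimage_algebra (space (XZ_space N p)) (observation N s) (\<Pi>\<^sub>M i\<in>{..<N}. borel)"

(* The conditional expectation of the vector X is taken coordinatewise. *)
definition posterior_mean ::
  "nat \<Rightarrow> (nat \<Rightarrow> real) pmf \<Rightarrow> real \<Rightarrow> (nat \<Rightarrow> real) \<times> (nat \<Rightarrow> real) \<Rightarrow> (nat \<Rightarrow> real)" where
  "posterior_mean N p s \<omega> =
     (\<lambda>i\<in>{..<N}. real_cond_exp (XZ_space N p) (sigma_obs N p s) (\<lambda>(x, z). x i) \<omega>)"

definition MMSE :: "nat \<Rightarrow> (nat \<Rightarrow> real) pmf \<Rightarrow> real \<Rightarrow> ennreal" where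
  "MMSE N p s =
     (\<integral>\<^sup>+ \<omega>. ennreal ((euc_dist N (fst \<omega>) (posterior_mean N p s \<omega>))\<^sup>2) \<partial>XZ_space N p)"

definition integrated_bayes_risk :: "nat \<Rightarrow> (nat \<Rightarrow> real) set \<Rightarrow> ennreal" where
  "integrated_bayes_risk N T = (SUP p\<in>prob_on T. \<integral>\<^sup>+ s\<in>{0..}. MMSE N p s \<partial>lborel)"

(* real_cond_exp is the genuine conditional expectation only for a sigma-finite subalgebra. *)
lemma sigma_finite_subalgebra_sigma_obs:
  "sigma_finite_subalgebra (XZ_space N p) (sigma_obs N p s)"
proof -
  interpret G: prob_space "density lborel (\<lambda>x. ennreal (std_normal_density x))"
    by (rule prob_space_normal_density) simp
  interpret GG: product_prob_space "\<lambda>_::nat. density lborel (\<lambda>x. ennreal (std_normal_density x))"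
    by unfold_locales
  interpret SG: prob_space "std_gaussian N"
    unfolding std_gaussian_def by (rule prob_space_PiM) unfold_locales
  interpret P: pair_prob_space "measure_pmf p" "std_gaussian N" ..
  have sets_G: "sets (std_gaussian N) = sets (\<Pi>\<^sub>M i\<in>{..<N}. (borel :: real measure))"
    unfolding std_gaussian_def by (rule sets_PiM_cong) auto
  have "(\<lambda>\<omega>. snd \<omega> i) \<in> borel_measurable (XZ_space N p)" if "i < N" for i
    unfolding XZ_space_def
    using that by (intro measurable_compose[OF measurable_snd])
      (simp add: measurable_cong_sets[OF sets_G refl])
  moreover have "(\<lambda>\<omega>. fst \<omega> i) \<in> borel_measurable (XZ_space N p)" for i
    unfolding XZ_space_def by (rule measurable_compose[OF measurable_fst]) simp
  ultimately have "observation N s \<in> XZ_space N p \<rightarrow>\<^sub>M (\<Pi>\<^sub>M i\<in>{..<N}. borel)"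
    unfolding observation_def case_prod_beta by (intro measurable_restrict) auto
  then have "subalgebra (XZ_space N p) (sigma_obs N p s)"
    unfolding subalgebra_def sigma_obs_def
    by (auto simp: sets_vimage_algebra2 measurable_space measurable_sets Pi_iff)
  moreover have "finite_measure (XZ_space N p)"
    unfolding XZ_space_def by unfold_locales
  ultimately show ?thesis
    by (intro finite_measure_subalgebra_is_sigma_finite)
       (simp add: finite_measure_subalgebra_def finite_measure_subalgebra_axioms_def)
qed

end

theory Submission
  imports Defs
begin

text \<open>
The proof rests on two observations.

First, Gaussian observations cannot distinguish a point from much more numerous neighbours at
the same scale. Let \<open>X'\<close> be drawn from the posterior given \<open>Y\<^sub>s\<close>, independently of \<open>X\<close>; then the
mean-squared error is one half of the expectation of \<open>\<parallel>X - X'\<parallel>\<^sup>2\<close>. Conditionally on \<open>X = x\<close>, the posterior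
odds of the ball \<open>B(x,r)\<close> against the shell \<open>B(x,2r) - B(x,r)\<close> have expectation at most
\<open>exp (8 s\<^sup>2 r\<^sup>2)\<close> times the prior odds, which is a moment generating function computation. Hence, as
soon as \<open>ln (\<pi>(B(x,2r)) / \<pi>(B(x,r))) \<ge> 1 + 8 s\<^sup>2 r\<^sup>2\<close>, the expectation of \<open>\<parallel>x - X'\<parallel>\<^sup>2\<close> given \<open>X = x\<close>
is at least \<open>r\<^sup>2 / 2\<close> (lemma \<open>local_risk_ge_scale\<close>). Integrating over \<open>s\<close> and exchanging the two
integrals turns this into a bound for the integral over \<open>r\<close> of the square root of the log-ratio of
the masses of \<open>B(x,2r)\<close> and \<open>B(x,r)\<close>. Since \<open>ln (1 / \<pi>(B(x,r)))\<close> is the sum of that log-ratio and of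
\<open>ln (1 / \<pi>(B(x,2r)))\<close>, and since the substitution \<open>r \<mapsto> 2r\<close> halves the integral of the square root of
the latter, the whole entropy integral at \<open>x\<close> is controlled, up to a multiple of the diameter
(lemma \<open>entropy_integral_le_local_risk\<close>). The inequality holds for each \<open>\<pi>\<close> separately,
after averaging over \<open>x\<close>.

Second, there is a law \<open>\<pi>\<close> whose own average entropy integral is at least \<open>\<M>(T,d)\<close> minus a multiple
of the diameter (lemma \<open>exists_entropic_law\<close>). Such a \<open>\<pi>\<close> could be taken from a minimax theorem; here it
is one of the iterates of the multiplicative weights algorithm, played against itself with the payoff
\<open>\<integral> sqrt (1 + ln (1 / \<mu>(B(t,r)))) dr\<close>, where \<open>\<mu>\<close> mixes the current weights with the uniform law.
The added 1 makes the payoff convex in \<open>\<mu>\<close>, so the average of the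
iterates does at least as well as the iterates on average, and the regret bound
(lemma \<open>self_play\<close>) compares its worst point with the average payoff of some iterate.

The diameter itself is bounded by the integrated risk of the uniform law on two points that realise
it (lemma \<open>MMSE_two_point\<close>).
\<close>

section \<open>Translations of the standard Gaussian measure\<close>

abbreviation gauss1 :: "real measure" where
  "gauss1 \<equiv> density lborel (\<lambda>x. ennreal (std_normal_density x))"

text \<open>
The density of \<open>N(v, I\<^sub>N)\<close> with respect to \<open>N(0, I\<^sub>N)\<close>.
\<close>

definition cm_density :: "nat \<Rightarrow> (nat \<Rightarrow> real) \<Rightarrow> (nat \<Rightarrow> real) \<Rightarrow> real" where
  "cm_density N v y = exp (\<Sum>i<N. v i * y i - (v i)\<^sup>2 / 2)"

lemma cm_density_pos: "cm_density N v y > 0"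
  by (simp add: cm_density_def)

lemma prob_space_gauss1: "prob_space gauss1"
  by (rule prob_space_normal_density) simp

lemma nn_integral_gauss1_shift:
  assumes [measurable]: "f \<in> borel_measurable borel"
  shows "(\<integral>\<^sup>+ z. f (a + z) \<partial>gauss1) = (\<integral>\<^sup>+ y. f y * ennreal (exp (a * y - a\<^sup>2 / 2)) \<partial>gauss1)"
proof -
  have "(\<integral>\<^sup>+ y. f y * ennreal (exp (a * y - a\<^sup>2 / 2)) \<partial>gauss1) =
      (\<integral>\<^sup>+ y. ennreal (std_normal_density y) * (f y * ennreal (exp (a * y - a\<^sup>2 / 2))) \<partial>lborel)"
    by (subst nn_integral_density) auto
  also have "\<dots> = (\<integral>\<^sup>+ y. ennreal (std_normal_density (y - a)) * f y \<partial>lborel)"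
  proof (intro nn_integral_cong)
    fix y :: real
    have "std_normal_density y * exp (a * y - a\<^sup>2 / 2) = std_normal_density (y - a)"
      unfolding std_normal_density_def mult.assoc exp_add[symmetric]
      by (simp add: power2_diff field_simps)
    then show "ennreal (std_normal_density y) * (f y * ennreal (exp (a * y - a\<^sup>2 / 2))) =
        ennreal (std_normal_density (y - a)) * f y"
      by (subst mult.left_commute, subst ennreal_mult[symmetric]) (auto simp: mult.commute)
  qed
  also have "\<dots> = (\<integral>\<^sup>+ z. ennreal (std_normal_density z) * f (a + z) \<partial>lborel)"
    by (subst nn_integral_real_affine[where c = 1 and t = a]) auto
  also have "\<dots> = (\<integral>\<^sup>+ z. f (a + z) \<partial>gauss1)"
    by (subst nn_integral_density) auto
  finally show ?thesis ..
qed

lemma sets_std_gaussian [measurable_cong]: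
  "sets (std_gaussian N) = sets (\<Pi>\<^sub>M i\<in>{..<N}. (borel :: real measure))"
  unfolding std_gaussian_def by (rule sets_PiM_cong) auto

lemma space_std_gaussian: "space (std_gaussian N) = RN N"
  using sets_eq_imp_space_eq[OF sets_std_gaussian] by (simp add: space_PiM RN_def)

lemma prob_space_std_gaussian: "prob_space (std_gaussian N)"
  unfolding std_gaussian_def by (intro prob_space_PiM prob_space_gauss1)

lemma measurable_cm_density [measurable]: "cm_density N v \<in> borel_measurable (std_gaussian N)"
  unfolding cm_density_def[abs_def] by measurable

text \<open>
The Cameron--Martin formula. Both the translated Gaussian and the weighted Gaussian are products
of the same one-dimensional laws, and a product measure is determined by its values on boxes.
\<close>

lemma nn_integral_gaussian_shift:
  assumes [measurable]: "f \<in> borel_measurable (std_gaussian N)"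
  shows "(\<integral>\<^sup>+ z. f (\<lambda>i\<in>{..<N}. v i + z i) \<partial>std_gaussian N) =
    (\<integral>\<^sup>+ y. f y * ennreal (cm_density N v y) \<partial>std_gaussian N)"
proof -
  interpret G: product_sigma_finite "\<lambda>_::nat. gauss1"
    by (intro product_sigma_finite.intro prob_space_imp_sigma_finite prob_space_gauss1)
  define M where "M i = density gauss1 (\<lambda>y. ennreal (exp (v i * y - (v i)\<^sup>2 / 2)))" for i
  have [measurable_cong]: "sets (M i) = sets borel" for i by (simp add: M_def)
  have M: "emeasure (M i) A = (\<integral>\<^sup>+ z. indicator A (v i + z) \<partial>gauss1)" if [measurable]: "A \<in> sets borel" for A i
    unfolding M_def using nn_integral_gauss1_shift[of "indicator A" "v i"]
    by (subst emeasure_density) (auto simp: mult.commute)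
  have "prob_space (M i)" for i
    by rule (use M[of UNIV i] prob_space.emeasure_space_1[OF prob_space_gauss1] in \<open>simp add: M_def\<close>)
  then interpret M: product_sigma_finite M
    by (intro product_sigma_finite.intro prob_space_imp_sigma_finite)
  have sM: "sets (Pi\<^sub>M {..<N} M) = sets (std_gaussian N)"
    unfolding sets_std_gaussian by (rule sets_PiM_cong) (auto simp: M_def)
  have "distr (std_gaussian N) (std_gaussian N) (\<lambda>z. \<lambda>i\<in>{..<N}. v i + z i) = Pi\<^sub>M {..<N} M"
  proof (rule M.PiM_eqI)
    fix A assume "\<And>i. i \<in> {..<N} \<Longrightarrow> A i \<in> sets (M i)"
    then have [measurable]: "\<And>i. i \<in> {..<N} \<Longrightarrow> A i \<in> sets borel" by (simp add: M_def)
    have A: "Pi\<^sub>E {..<N} A \<in> sets (std_gaussian N)"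
      unfolding sets_std_gaussian by (intro sets_PiM_I_finite) auto
    have "emeasure (distr (std_gaussian N) (std_gaussian N) (\<lambda>z. \<lambda>i\<in>{..<N}. v i + z i)) (Pi\<^sub>E {..<N} A)
        = (\<integral>\<^sup>+ z. indicator (Pi\<^sub>E {..<N} A) (\<lambda>i\<in>{..<N}. v i + z i) \<partial>std_gaussian N)"
      using A by (simp flip: nn_integral_indicator add: nn_integral_distr)
    also have "\<dots> = (\<integral>\<^sup>+ z. (\<Prod>i<N. indicator (A i) (v i + z i)) \<partial>std_gaussian N)"
      by (intro nn_integral_cong) (auto simp: indicator_def PiE_iff Pi_iff)
    also have "\<dots> = (\<Prod>i<N. emeasure (M i) (A i))"
      unfolding std_gaussian_def by (subst G.product_nn_integral_prod) (auto simp: M intro!: prod.cong)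
    finally show "emeasure (distr (std_gaussian N) (std_gaussian N) (\<lambda>z. \<lambda>i\<in>{..<N}. v i + z i)) (Pi\<^sub>E {..<N} A)
      = (\<Prod>i<N. emeasure (M i) (A i))" .
  qed (auto simp: sM)
  also have "Pi\<^sub>M {..<N} M = density (std_gaussian N) (\<lambda>y. ennreal (cm_density N v y))"
  proof (rule M.PiM_eqI[symmetric])
    fix A assume "\<And>i. i \<in> {..<N} \<Longrightarrow> A i \<in> sets (M i)"
    then have [measurable]: "\<And>i. i \<in> {..<N} \<Longrightarrow> A i \<in> sets borel" by (simp add: M_def)
    have A: "Pi\<^sub>E {..<N} A \<in> sets (std_gaussian N)"
      unfolding sets_std_gaussian by (intro sets_PiM_I_finite) auto
    have "emeasure (density (std_gaussian N) (\<lambda>y. ennreal (cm_density N v y))) (Pi\<^sub>E {..<N} A) =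
        (\<integral>\<^sup>+ y. ennreal (cm_density N v y) * indicator (Pi\<^sub>E {..<N} A) y \<partial>std_gaussian N)"
      using A by (subst emeasure_density) auto
    also have "\<dots> = (\<integral>\<^sup>+ y. (\<Prod>i<N. ennreal (exp (v i * y i - (v i)\<^sup>2 / 2)) * indicator (A i) (y i)) \<partial>std_gaussian N)"
    proof (intro nn_integral_cong)
      fix y assume "y \<in> space (std_gaussian N)"
      then have "(indicator (Pi\<^sub>E {..<N} A) y :: ennreal) = (\<Prod>i<N. indicator (A i) (y i))"
        by (auto simp: indicator_def PiE_iff Pi_iff space_std_gaussian RN_def)
      then show "ennreal (cm_density N v y) * indicator (Pi\<^sub>E {..<N} A) y =
          (\<Prod>i<N. ennreal (exp (v i * y i - (v i)\<^sup>2 / 2)) * indicator (A i) (y i))"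
        by (simp add: cm_density_def exp_sum prod.distrib prod_ennreal)
    qed
    also have "\<dots> = (\<Prod>i<N. emeasure (M i) (A i))"
      unfolding std_gaussian_def M_def
      by (subst G.product_nn_integral_prod) (auto simp: emeasure_density intro!: prod.cong)
    finally show "emeasure (density (std_gaussian N) (\<lambda>y. ennreal (cm_density N v y))) (Pi\<^sub>E {..<N} A)
      = (\<Prod>i<N. emeasure (M i) (A i))" .
  qed (auto simp: sM)
  finally have eq: "distr (std_gaussian N) (std_gaussian N) (\<lambda>z. \<lambda>i\<in>{..<N}. v i + z i) =
      density (std_gaussian N) (\<lambda>y. ennreal (cm_density N v y))" .
  have "(\<integral>\<^sup>+ z. f (\<lambda>i\<in>{..<N}. v i + z i) \<partial>std_gaussian N) =
      (\<integral>\<^sup>+ y. f y \<partial>distr (std_gaussian N) (std_gaussian N) (\<lambda>z. \<lambda>i\<in>{..<N}. v i + z i))"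
    by (simp add: nn_integral_distr)
  then show ?thesis
    by (simp add: eq nn_integral_density mult.commute)
qed

lemma nn_integral_cm_density: "(\<integral>\<^sup>+ y. ennreal (cm_density N v y) \<partial>std_gaussian N) = 1"
  using nn_integral_gaussian_shift[of "\<lambda>_. 1" N v]
    prob_space.emeasure_space_1[OF prob_space_std_gaussian[of N]] by simp

text \<open>
The only moment computation of the proof: under \<open>N(u, I\<^sub>N)\<close>, the expected likelihood ratio of
the means \<open>a\<close> and \<open>b\<close>. The integrand is, up to a constant, the density with mean \<open>u + a - b\<close>.
\<close>

lemma nn_integral_cm_density_quotient:
  "(\<integral>\<^sup>+ y. ennreal (cm_density N u y * cm_density N a y / cm_density N b y) \<partial>std_gaussian N) =
    ennreal (exp (\<Sum>i<N. (b i - u i) * (b i - a i)))"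
proof -
  have "cm_density N u y * cm_density N a y / cm_density N b y =
      exp (\<Sum>i<N. (b i - u i) * (b i - a i)) * cm_density N (\<lambda>i. u i + a i - b i) y" for y
    unfolding cm_density_def exp_add[symmetric] exp_diff[symmetric] sum.distrib[symmetric]
      sum_subtractf[symmetric]
    by (intro arg_cong[where f = exp] sum.cong) (auto simp: power2_eq_square field_simps)
  then show ?thesis
    by (simp add: ennreal_mult cm_density_pos[THEN less_imp_le] nn_integral_cmult nn_integral_cm_density)
qed

section \<open>The mean-squared error and posterior samples\<close>

lemma euc_dist_sq: "(euc_dist N x y)\<^sup>2 = (\<Sum>i<N. (x i - y i)\<^sup>2)"
  by (simp add: euc_dist_def L2_set_def sum_nonneg)

text \<open>
Each level set of \<open>f\<close> is the preimage of some set under \<open>g\<close>.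
\<close>

lemma vimage_algebra_const_on_fibres:
  fixes f :: "'a \<Rightarrow> real"
  assumes f: "f \<in> borel_measurable (vimage_algebra X g M)" and g: "g \<in> X \<rightarrow> space M"
    and xy: "x \<in> X" "y \<in> X" "g x = g y"
  shows "f x = f y"
proof -
  have "f -` {f x} \<inter> X \<in> sets (vimage_algebra X g M)"
    using measurable_sets[OF f, of "{f x}"] by simp
  then obtain A where "f -` {f x} \<inter> X = g -` A \<inter> X"
    using g by (auto simp: sets_vimage_algebra2)
  moreover have "x \<in> f -` {f x} \<inter> X" using xy by simp
  ultimately have "y \<in> f -` {f x} \<inter> X" using xy by auto
  then show ?thesis by simp
qed

text \<open>
The variance is half the mean squared distance of two independent copies, and is the least mean
squared deviation from a constant.
\<close>

lemma weighted_variance_ge: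
  fixes w f :: "'a \<Rightarrow> real"
  assumes "finite S" and pos: "sum w S > 0"
  shows "(\<Sum>x\<in>S. w x * ((\<Sum>u\<in>S. w u * (f x - f u)\<^sup>2) / sum w S)) / 2 \<le> (\<Sum>x\<in>S. w x * (f x - c)\<^sup>2)"
proof -
  define g where "g x = f x - c" for x
  define W where "W = sum w S"
  have "(\<Sum>x\<in>S. w x * (\<Sum>u\<in>S. w u * (f x - f u)\<^sup>2)) =
      (\<Sum>x\<in>S. \<Sum>u\<in>S. w u * (w x * (g x)\<^sup>2) + w x * (w u * (g u)\<^sup>2) - 2 * ((w x * g x) * (w u * g u)))"
    by (simp add: sum_distrib_left g_def power2_eq_square algebra_simps)
  also have "\<dots> = 2 * (W * (\<Sum>x\<in>S. w x * (g x)\<^sup>2)) - 2 * (\<Sum>x\<in>S. w x * g x)\<^sup>2"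
    unfolding sum.distrib sum_subtractf sum_distrib_left[symmetric] sum_distrib_right[symmetric]
      W_def[symmetric] power2_eq_square by (simp add: mult.commute)
  also have "\<dots> \<le> 2 * W * (\<Sum>x\<in>S. w x * (g x)\<^sup>2)" by simp
  finally have "(\<Sum>x\<in>S. w x * (\<Sum>u\<in>S. w u * (f x - f u)\<^sup>2)) / (2 * W) \<le> (\<Sum>x\<in>S. w x * (g x)\<^sup>2)"
    using pos by (simp add: W_def field_simps)
  moreover have "(\<Sum>x\<in>S. w x * ((\<Sum>u\<in>S. w u * (f x - f u)\<^sup>2) / sum w S)) / 2 =
      (\<Sum>x\<in>S. w x * (\<Sum>u\<in>S. w u * (f x - f u)\<^sup>2)) / (2 * W)"
    unfolding sum_divide_distrib[of _ S] W_def by (simp add: sum_divide_distrib[symmetric] mult.commute)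
  ultimately show ?thesis by (simp add: g_def)
qed

text \<open>
By Bayes' formula, these are the unnormalised posterior probabilities of \<open>X = u\<close> given \<open>Y\<^sub>s = y\<close>.
\<close>

definition post_weight :: "nat \<Rightarrow> (nat \<Rightarrow> real) pmf \<Rightarrow> real \<Rightarrow> (nat \<Rightarrow> real) \<Rightarrow> (nat \<Rightarrow> real) \<Rightarrow> real" where
  "post_weight N p s u y = pmf p u * cm_density N (\<lambda>i. s * u i) y"

text \<open>
The posterior mean of \<open>\<parallel>x - X'\<parallel>\<^sup>2\<close> given \<open>Y\<^sub>s = y\<close>.
\<close>

definition post_spread :: "nat \<Rightarrow> (nat \<Rightarrow> real) pmf \<Rightarrow> real \<Rightarrow> (nat \<Rightarrow> real) \<Rightarrow> (nat \<Rightarrow> real) \<Rightarrow> real" where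
  "post_spread N p s x y =
     (\<Sum>u\<in>set_pmf p. post_weight N p s u y * (euc_dist N x u)\<^sup>2) / (\<Sum>u\<in>set_pmf p. post_weight N p s u y)"

text \<open>
The mean of \<open>\<parallel>x - X'\<parallel>\<^sup>2\<close> given \<open>X = x\<close>, where \<open>X'\<close> is drawn from the posterior given \<open>Y\<^sub>s\<close>:
conditionally on \<open>X = x\<close>, the observation has the density \<open>cm_density N (s x)\<close>.
\<close>

definition local_risk :: "nat \<Rightarrow> (nat \<Rightarrow> real) pmf \<Rightarrow> real \<Rightarrow> (nat \<Rightarrow> real) \<Rightarrow> ennreal" where
  "local_risk N p s x =
     (\<integral>\<^sup>+ y. ennreal (post_spread N p s x y) * ennreal (cm_density N (\<lambda>i. s * x i) y) \<partial>std_gaussian N)"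

lemma post_weight_nonneg: "post_weight N p s u y \<ge> 0"
  by (simp add: post_weight_def cm_density_pos[THEN less_imp_le])

lemma post_weight_pos: "u \<in> set_pmf p \<Longrightarrow> post_weight N p s u y > 0"
  by (simp add: post_weight_def cm_density_pos pmf_positive)

lemma sum_post_weight_pos:
  "finite (set_pmf p) \<Longrightarrow> (\<Sum>u\<in>set_pmf p. post_weight N p s u y) > 0"
  by (intro sum_pos post_weight_pos set_pmf_not_empty)

lemma post_spread_nonneg: "post_spread N p s x y \<ge> 0"
  unfolding post_spread_def by (intro divide_nonneg_nonneg sum_nonneg mult_nonneg_nonneg post_weight_nonneg) simp

lemma measurable_post_weight [measurable]: "post_weight N p s u \<in> borel_measurable (std_gaussian N)"
  unfolding post_weight_def[abs_def] by measurable

lemma measurable_post_spread [measurable]: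
  "post_spread N p s x \<in> borel_measurable (std_gaussian N)"
  unfolding post_spread_def[abs_def] by measurable

lemma post_spread_le_error:
  assumes "finite (set_pmf p)"
  shows "(\<Sum>x\<in>set_pmf p. post_weight N p s x y * post_spread N p s x y) / 2
    \<le> (\<Sum>x\<in>set_pmf p. post_weight N p s x y * (\<Sum>i<N. (x i - h i)\<^sup>2))"
proof -
  let ?S = "set_pmf p" and ?w = "\<lambda>x. post_weight N p s x y"
  have "post_spread N p s x y = (\<Sum>i<N. (\<Sum>u\<in>?S. ?w u * (x i - u i)\<^sup>2) / sum ?w ?S)" for x
    unfolding post_spread_def euc_dist_sq sum_distrib_left sum_divide_distrib by (rule sum.swap)
  then have "(\<Sum>x\<in>?S. ?w x * post_spread N p s x y) / 2 =
      (\<Sum>i<N. (\<Sum>x\<in>?S. ?w x * ((\<Sum>u\<in>?S. ?w u * (x i - u i)\<^sup>2) / sum ?w ?S)) / 2)"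
    by (simp only: sum_distrib_left sum_divide_distrib[of _ _ 2]) (rule sum.swap)
  also have "\<dots> \<le> (\<Sum>i<N. \<Sum>x\<in>?S. ?w x * (x i - h i)\<^sup>2)"
    by (intro sum_mono weighted_variance_ge sum_post_weight_pos assms)
  also have "\<dots> = (\<Sum>x\<in>?S. ?w x * (\<Sum>i<N. (x i - h i)\<^sup>2))"
    unfolding sum_distrib_left by (rule sum.swap)
  finally show ?thesis .
qed

lemma observation_in_RN: "observation N s \<omega> \<in> RN N"
  by (auto simp: observation_def RN_def split: prod.splits)

text \<open>
Conditional expectations given the observation are constant where the observation is. The observation
of \<open>(0, y)\<close> is \<open>y\<close> itself, so the factor \<open>h\<close> can be read off on the section \<open>x = 0\<close>, which makes it
measurable.
\<close>

lemma posterior_mean_factors: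
  "\<exists>h :: nat \<Rightarrow> (nat \<Rightarrow> real) \<Rightarrow> real. (\<forall>i. h i \<in> borel_measurable (std_gaussian N)) \<and>
    (\<forall>x i. \<forall>z\<in>space (std_gaussian N). real_cond_exp (XZ_space N p) (sigma_obs N p s) (\<lambda>(x, z). x i) (x, z)
      = h i (observation N s (x, z)))"
proof -
  define f where "f i = real_cond_exp (XZ_space N p) (sigma_obs N p s) (\<lambda>(x, z). x i)" for i :: nat
  define h where "h i y = f i (\<lambda>_. 0, y)" for i y
  have fm: "f i \<in> borel_measurable (measure_pmf p \<Otimes>\<^sub>M std_gaussian N)" for i
    unfolding f_def XZ_space_def[symmetric] by (rule borel_measurable_cond_exp2)
  have "h i \<in> borel_measurable (std_gaussian N)" for i
    unfolding h_def by (rule measurable_compose[OF measurable_Pair1' fm]) simp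
  moreover have "f i (x, z) = h i (observation N s (x, z))" if "z \<in> space (std_gaussian N)" for i x z
    unfolding h_def
  proof (rule vimage_algebra_const_on_fibres[where f = "f i" and X = "space (XZ_space N p)"
        and g = "observation N s" and M = "\<Pi>\<^sub>M i\<in>{..<N}. borel"])
    show "f i \<in> borel_measurable (vimage_algebra (space (XZ_space N p)) (observation N s) (\<Pi>\<^sub>M i\<in>{..<N}. borel))"
      unfolding f_def sigma_obs_def[symmetric] by (rule borel_measurable_cond_exp)
    show "observation N s \<in> space (XZ_space N p) \<rightarrow> space (\<Pi>\<^sub>M i\<in>{..<N}. borel)"
      using observation_in_RN by (auto simp: space_PiM RN_def)
    show "(x, z) \<in> space (XZ_space N p)" "(\<lambda>_. 0, observation N s (x, z)) \<in> space (XZ_space N p)"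
      using that observation_in_RN by (auto simp: XZ_space_def space_pair_measure space_std_gaussian)
    show "observation N s (x, z) = observation N s (\<lambda>_. 0, observation N s (x, z))"
      by (auto simp: observation_def)
  qed
  ultimately show ?thesis
    unfolding f_def[symmetric] by (intro exI[of _ h]) auto
qed

text \<open>
For any estimator \<open>h(Y\<^sub>s)\<close>, changing variables to the observation \<open>y\<close> writes the error as an integral
over \<open>y\<close> of posterior sums, to which the variance inequality applies for each \<open>y\<close>.
\<close>

theorem MMSE_ge_local_risk:
  assumes fin: "finite (set_pmf p)"
  shows "(\<Sum>x\<in>set_pmf p. ennreal (pmf p x) * local_risk N p s x) / 2 \<le> MMSE N p s"
proof -
  interpret G: prob_space "std_gaussian N" by (rule prob_space_std_gaussian)
  obtain h where h [measurable]: "\<And>i. h i \<in> borel_measurable (std_gaussian N)"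
    and h_eq: "\<And>x z i. z \<in> space (std_gaussian N) \<Longrightarrow>
      real_cond_exp (XZ_space N p) (sigma_obs N p s) (\<lambda>(x, z). x i) (x, z) = h i (observation N s (x, z))"
    using posterior_mean_factors[of N p s] by metis
  define err where "err x y = (\<Sum>i<N. (x i - h i y)\<^sup>2)" for x y
  have err_nonneg: "err x y \<ge> 0" for x y by (simp add: err_def sum_nonneg)
  have [measurable]: "err x \<in> borel_measurable (std_gaussian N)" for x
    unfolding err_def[abs_def] by measurable
  have pm: "(euc_dist N x (posterior_mean N p s (x, z)))\<^sup>2 = err x (\<lambda>i\<in>{..<N}. s * x i + z i)"
    if "z \<in> space (std_gaussian N)" for x z
    using h_eq[OF that] by (simp add: euc_dist_sq posterior_mean_def err_def observation_def)
  have meas: "(\<lambda>\<omega>. ennreal ((euc_dist N (fst \<omega>) (posterior_mean N p s \<omega>))\<^sup>2))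
      \<in> borel_measurable (measure_pmf p \<Otimes>\<^sub>M std_gaussian N)"
  proof -
    have [measurable]: "(\<lambda>\<omega>. fst \<omega> i) \<in> borel_measurable (measure_pmf p \<Otimes>\<^sub>M std_gaussian N)" for i
      by (rule measurable_compose[OF measurable_fst]) simp
    have [measurable]: "real_cond_exp (XZ_space N p) F g \<in> borel_measurable (measure_pmf p \<Otimes>\<^sub>M std_gaussian N)" for F g
      using borel_measurable_cond_exp2 by (simp add: XZ_space_def)
    show ?thesis
      unfolding euc_dist_sq posterior_mean_def by simp
  qed
  have "MMSE N p s =
      (\<integral>\<^sup>+ x. \<integral>\<^sup>+ z. ennreal ((euc_dist N x (posterior_mean N p s (x, z)))\<^sup>2) \<partial>std_gaussian N \<partial>measure_pmf p)"
    unfolding MMSE_def XZ_space_def by (subst G.nn_integral_fst[OF meas, symmetric]) simp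
  also have "\<dots> = (\<integral>\<^sup>+ x. \<integral>\<^sup>+ z. ennreal (err x (\<lambda>i\<in>{..<N}. s * x i + z i)) \<partial>std_gaussian N \<partial>measure_pmf p)"
    by (intro nn_integral_cong) (simp add: pm)
  also have "\<dots> = (\<integral>\<^sup>+ x. \<integral>\<^sup>+ y. ennreal (err x y) * ennreal (cm_density N (\<lambda>i. s * x i) y) \<partial>std_gaussian N \<partial>measure_pmf p)"
    by (intro nn_integral_cong nn_integral_gaussian_shift) simp
  also have "\<dots> = (\<Sum>x\<in>set_pmf p. (\<integral>\<^sup>+ y. ennreal (err x y) * ennreal (cm_density N (\<lambda>i. s * x i) y) \<partial>std_gaussian N) * pmf p x)"
    using fin by (intro nn_integral_measure_pmf_finite) auto
  also have "\<dots> = (\<integral>\<^sup>+ y. ennreal (\<Sum>x\<in>set_pmf p. post_weight N p s x y * err x y) \<partial>std_gaussian N)"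
    by (subst nn_integral_multc[symmetric], simp, subst nn_integral_sum[symmetric], simp)
       (auto intro!: nn_integral_cong sum.cong
         simp: post_weight_def err_nonneg cm_density_pos[THEN less_imp_le] ennreal_mult mult_ac
         simp flip: sum_ennreal ennreal_mult)
  finally have 1: "MMSE N p s = \<dots>" .
  have "(\<Sum>x\<in>set_pmf p. ennreal (pmf p x) * local_risk N p s x) / 2 =
      (\<integral>\<^sup>+ y. ennreal (\<Sum>x\<in>set_pmf p. post_weight N p s x y * post_spread N p s x y) \<partial>std_gaussian N) / 2"
    unfolding local_risk_def
    by (subst nn_integral_cmult[symmetric], simp, subst nn_integral_sum[symmetric], simp)
       (auto intro!: nn_integral_cong sum.cong arg_cong[where f = "\<lambda>x. x / 2"]
         simp: post_weight_def post_spread_nonneg cm_density_pos[THEN less_imp_le] ennreal_mult mult_ac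
         simp flip: sum_ennreal ennreal_mult)
  also have "\<dots> = (\<integral>\<^sup>+ y. ennreal ((\<Sum>x\<in>set_pmf p. post_weight N p s x y * post_spread N p s x y) / 2) \<partial>std_gaussian N)"
  proof (subst nn_integral_divide[symmetric])
    have "ennreal (a / 2) = ennreal a / 2" if "a \<ge> 0" for a :: real
      using divide_ennreal[of a 2] that by simp
    moreover have "(\<Sum>x\<in>set_pmf p. post_weight N p s x y * post_spread N p s x y) \<ge> 0" for y
      by (intro sum_nonneg mult_nonneg_nonneg post_weight_nonneg post_spread_nonneg)
    ultimately show "(\<integral>\<^sup>+ y. ennreal (\<Sum>x\<in>set_pmf p. post_weight N p s x y * post_spread N p s x y) / 2 \<partial>std_gaussian N)
      = (\<integral>\<^sup>+ y. ennreal ((\<Sum>x\<in>set_pmf p. post_weight N p s x y * post_spread N p s x y) / 2) \<partial>std_gaussian N)"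
      by simp
  qed simp
  also have "\<dots> \<le> MMSE N p s"
    unfolding 1 err_def by (intro nn_integral_mono ennreal_leI post_spread_le_error fin)
  finally show ?thesis .
qed

section \<open>A lower bound for the spread of the posterior\<close>

lemma square_sum_le_weighted:
  fixes p e :: "'a \<Rightarrow> real"
  assumes "\<And>b. b \<in> B \<Longrightarrow> p b \<ge> 0" and "\<And>b. b \<in> B \<Longrightarrow> e b > 0"
  shows "(\<Sum>b\<in>B. p b)\<^sup>2 \<le> (\<Sum>b\<in>B. p b * e b) * (\<Sum>b\<in>B. p b / e b)"
proof -
  have "(\<Sum>b\<in>B. p b) = (\<Sum>b\<in>B. sqrt (p b * e b) * sqrt (p b / e b))"
    using assms by (intro sum.cong) (force simp: real_sqrt_mult[symmetric] less_imp_le)+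
  also have "\<dots>\<^sup>2 \<le> (\<Sum>b\<in>B. (sqrt (p b * e b))\<^sup>2) * (\<Sum>b\<in>B. (sqrt (p b / e b))\<^sup>2)"
    by (rule Cauchy_Schwarz_ineq_sum)
  also have "(\<Sum>b\<in>B. (sqrt (p b * e b))\<^sup>2) = (\<Sum>b\<in>B. p b * e b)"
    using assms by (intro sum.cong) (auto simp: less_imp_le)
  also have "(\<Sum>b\<in>B. (sqrt (p b / e b))\<^sup>2) = (\<Sum>b\<in>B. p b / e b)"
    using assms by (intro sum.cong) (auto simp: less_imp_le)
  finally show ?thesis .
qed

text \<open>
As a lower bound for \<open>1 / (1 + t)\<close> that is affine in \<open>t\<close>, this lets the expectation of a posterior
probability be bounded through the expectation of the odds \<open>t\<close>. The choice \<open>l = 1 / (1 + m)\<close> is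
the tangent at \<open>t = m\<close>.
\<close>

lemma inverse_ge_tangent:
  fixes l t :: real
  assumes "t \<ge> 0"
  shows "2 * l - l\<^sup>2 * (1 + t) \<le> 1 / (1 + t)"
proof -
  have "(2 * l - l\<^sup>2 * (1 + t)) * (1 + t) = 1 - (1 - l * (1 + t))\<^sup>2"
    by (simp add: power2_eq_square algebra_simps)
  also have "\<dots> \<le> 1" by simp
  finally show ?thesis using assms by (simp add: field_simps)
qed

text \<open>
The exponent of the expected likelihood ratio of \<open>s a\<close> and \<open>s b\<close> under the law with mean \<open>s x\<close>. Being
\<open>s\<^sup>2 \<langle>b - x, (b - x) - (a - x)\<rangle>\<close>, it does not involve the position of \<open>x\<close>.
\<close>

lemma inner_product_bound:
  assumes "euc_dist N x a \<le> R" "euc_dist N x b \<le> R"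
  shows "(\<Sum>i<N. (s * b i - s * x i) * (s * b i - s * a i)) \<le> 2 * s\<^sup>2 * R\<^sup>2"
proof -
  have nn: "euc_dist N x u \<ge> 0" for u by (simp add: euc_dist_def)
  have "(s * b i - s * x i) * (s * b i - s * a i) \<le> s\<^sup>2 * (3 / 2 * (x i - b i)\<^sup>2 + 1 / 2 * (x i - a i)\<^sup>2)" for i
  proof -
    have "(b i - x i) * (b i - a i) \<le> 3 / 2 * (x i - b i)\<^sup>2 + 1 / 2 * (x i - a i)\<^sup>2"
      using zero_le_power2[of "b i - x i + (a i - x i)"]
      by (simp add: power2_eq_square algebra_simps)
    then show ?thesis
      using mult_left_mono[of _ _ "s\<^sup>2"] by (fastforce simp: power2_eq_square algebra_simps)
  qed
  then have "(\<Sum>i<N. (s * b i - s * x i) * (s * b i - s * a i))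
      \<le> (\<Sum>i<N. s\<^sup>2 * (3 / 2 * (x i - b i)\<^sup>2 + 1 / 2 * (x i - a i)\<^sup>2))"
    by (rule sum_mono)
  also have "\<dots> = s\<^sup>2 * (3 / 2 * (euc_dist N x b)\<^sup>2 + 1 / 2 * (euc_dist N x a)\<^sup>2)"
    by (simp add: euc_dist_sq sum_distrib_left sum.distrib algebra_simps)
  also have "\<dots> \<le> s\<^sup>2 * (3 / 2 * R\<^sup>2 + 1 / 2 * R\<^sup>2)"
    using assms nn by (intro mult_left_mono add_mono power_mono) auto
  finally show ?thesis by (simp add: algebra_simps)
qed

text \<open>
The posterior mass outside \<open>A\<close> is \<open>1 / (1 + t)\<close> with \<open>t\<close> at most the posterior odds of \<open>A\<close> against \<open>B\<close>.
By the Cauchy--Schwarz inequality these odds are at most a weighted sum of the likelihood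
ratios of points of \<open>A\<close> against points of \<open>B\<close>, whose expectations are explicit.
\<close>

lemma post_spread_ge:
  fixes s :: real
  assumes fin: "finite (set_pmf p)"
    and sub: "A \<subseteq> set_pmf p" "B \<subseteq> set_pmf p - A" "B \<noteq> {}"
    and far: "\<And>u. u \<in> set_pmf p - A \<Longrightarrow> \<rho> \<le> euc_dist N x u" and "\<rho> \<ge> 0"
  defines "e \<equiv> \<lambda>u y. cm_density N (\<lambda>i. s * u i) y"
  shows "2 * l * \<rho>\<^sup>2 \<le> post_spread N p s x y +
     \<rho>\<^sup>2 * l\<^sup>2 * (1 + (\<Sum>a\<in>A. \<Sum>b\<in>B. pmf p a * pmf p b / (\<Sum>b\<in>B. pmf p b)\<^sup>2 * (e a y / e b y)))"
proof -
  let ?w = "\<lambda>u. post_weight N p s u y" and ?S = "set_pmf p"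
  define P where "P = (\<Sum>b\<in>B. pmf p b)"
  define T where "T = (\<Sum>a\<in>A. \<Sum>b\<in>B. pmf p a * pmf p b / P\<^sup>2 * (e a y / e b y))"
  have finB: "finite B" and finA: "finite A" using sub fin by (auto intro: finite_subset)
  have e: "e u y > 0" for u by (simp add: e_def cm_density_pos)
  have P: "P > 0" unfolding P_def using sub by (intro sum_pos finB pmf_positive) auto
  have B: "sum ?w B > 0" using sub by (intro sum_pos finB post_weight_pos) auto
  have A: "sum ?w A \<ge> 0" by (intro sum_nonneg post_weight_nonneg)
  have "sum ?w A / sum ?w B \<le> T"
  proof -
    have "P\<^sup>2 \<le> sum ?w B * (\<Sum>b\<in>B. pmf p b / e b y)"
      using square_sum_le_weighted[of B "pmf p" "\<lambda>u. e u y"] e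
      by (simp add: P_def post_weight_def e_def)
    then have "1 / sum ?w B \<le> (\<Sum>b\<in>B. pmf p b / e b y) / P\<^sup>2"
      using B P by (simp add: field_simps)
    then have "sum ?w A * (1 / sum ?w B) \<le> sum ?w A * ((\<Sum>b\<in>B. pmf p b / e b y) / P\<^sup>2)"
      by (intro mult_left_mono A)
    also have "\<dots> = T"
      unfolding T_def post_weight_def sum_product sum_divide_distrib times_divide_eq_right
      by (intro sum.cong) (auto simp: e_def mult_ac)
    finally show ?thesis by simp
  qed
  have diff: "sum ?w (?S - A) = sum ?w ?S - sum ?w A"
    using fin sub by (intro sum_diff) auto
  have BS: "sum ?w B \<le> sum ?w (?S - A)"
    using fin sub by (intro sum_mono2) (auto simp: post_weight_nonneg)
  have "2 * l - l\<^sup>2 * (1 + T) \<le> 2 * l - l\<^sup>2 * (1 + sum ?w A / sum ?w B)"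
    using \<open>sum ?w A / sum ?w B \<le> T\<close> by (simp add: mult_left_mono)
  also have "\<dots> \<le> 1 / (1 + sum ?w A / sum ?w B)"
    using A B by (intro inverse_ge_tangent) auto
  also have "\<dots> = sum ?w B / (sum ?w B + sum ?w A)"
    using A B by (simp add: field_simps)
  also have "\<dots> \<le> sum ?w (?S - A) / (sum ?w (?S - A) + sum ?w A)"
    using A B BS by (simp add: divide_simps add_pos_nonneg) (simp add: algebra_simps mult_left_mono)
  also have "\<dots> = sum ?w (?S - A) / sum ?w ?S" by (simp add: diff)
  finally have "\<rho>\<^sup>2 * (2 * l - l\<^sup>2 * (1 + T)) \<le> \<rho>\<^sup>2 * (sum ?w (?S - A) / sum ?w ?S)"
    by (intro mult_left_mono) auto
  also have "\<dots> = (\<Sum>u\<in>?S - A. ?w u * \<rho>\<^sup>2) / sum ?w ?S"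
    by (simp add: sum_distrib_left mult.commute)
  also have "\<dots> \<le> (\<Sum>u\<in>?S - A. ?w u * (euc_dist N x u)\<^sup>2) / sum ?w ?S"
    using far \<open>\<rho> \<ge> 0\<close>
    by (intro divide_right_mono sum_mono mult_left_mono power_mono sum_nonneg post_weight_nonneg) auto
  also have "\<dots> \<le> post_spread N p s x y"
    unfolding post_spread_def using fin
    by (intro divide_right_mono sum_mono2 sum_nonneg post_weight_nonneg) (auto simp: post_weight_nonneg)
  finally show ?thesis
    unfolding T_def P_def by (simp add: algebra_simps)
qed

text \<open>
If the prior odds of \<open>A\<close> against \<open>B\<close> are small enough to beat the factor by which the observation
increases them on average, a posterior sample tends to leave \<open>A\<close>, and then it is at
distance at least \<open>\<rho>\<close> from \<open>x\<close>.
\<close>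

theorem local_risk_ge:
  assumes fin: "finite (set_pmf p)"
    and sub: "A \<subseteq> set_pmf p" "B \<subseteq> set_pmf p - A" "B \<noteq> {}"
    and far: "\<And>u. u \<in> set_pmf p - A \<Longrightarrow> \<rho> \<le> euc_dist N x u" and "\<rho> \<ge> 0"
    and near: "\<And>u. u \<in> A \<union> B \<Longrightarrow> euc_dist N x u \<le> R"
    and odds: "(\<Sum>a\<in>A. pmf p a) * exp (2 * s\<^sup>2 * R\<^sup>2) \<le> m * (\<Sum>b\<in>B. pmf p b)" and "m \<ge> 0"
  shows "ennreal (\<rho>\<^sup>2 / (1 + m)) \<le> local_risk N p s x"
proof -
  define e where "e u y = cm_density N (\<lambda>i. s * u i) y" for u y
  define P where "P = (\<Sum>b\<in>B. pmf p b)"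
  define l where "l = 1 / (1 + m)"
  define k where "k a b = \<rho>\<^sup>2 * l\<^sup>2 * (pmf p a * pmf p b / P\<^sup>2)" for a b
  have finB: "finite B" and finA: "finite A" using sub fin by (auto intro: finite_subset)
  have e: "e u y > 0" for u y by (simp add: e_def cm_density_pos)
  have e': "0 \<le> e u y" for u y using e[of u y] by simp
  have P: "P > 0" unfolding P_def using sub by (intro sum_pos finB pmf_positive) auto
  have l: "l > 0" "l\<^sup>2 * (1 + m) = l" using \<open>m \<ge> 0\<close> by (auto simp: l_def power2_eq_square)
  have k: "k a b \<ge> 0" for a b by (simp add: k_def)
  have [measurable]: "e u \<in> borel_measurable (std_gaussian N)" for u
    unfolding e_def[abs_def] by measurable
  have int_e: "(\<integral>\<^sup>+ y. ennreal (e x y) \<partial>std_gaussian N) = 1"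
    unfolding e_def by (rule nn_integral_cm_density)
  \<comment> \<open>The negative terms are moved to the other side, because the integrals take values in \<open>[0, \<infinity>]\<close>.\<close>
  have pointwise: "ennreal (2 * l * \<rho>\<^sup>2) * ennreal (e x y) \<le>
      ennreal (post_spread N p s x y) * ennreal (e x y) + ennreal (\<rho>\<^sup>2 * l\<^sup>2) * ennreal (e x y) +
      (\<Sum>a\<in>A. \<Sum>b\<in>B. ennreal (k a b) * ennreal (e x y * e a y / e b y))" for y
  proof -
    have "2 * l * \<rho>\<^sup>2 * e x y \<le> (post_spread N p s x y +
        \<rho>\<^sup>2 * l\<^sup>2 * (1 + (\<Sum>a\<in>A. \<Sum>b\<in>B. pmf p a * pmf p b / P\<^sup>2 * (e a y / e b y)))) * e x y"
      unfolding e_def P_def using e'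
      by (intro mult_right_mono post_spread_ge fin sub far \<open>\<rho> \<ge> 0\<close>) (auto simp: e_def)
    also have "\<dots> = post_spread N p s x y * e x y + \<rho>\<^sup>2 * l\<^sup>2 * e x y +
        (\<Sum>a\<in>A. \<Sum>b\<in>B. k a b * (e x y * e a y / e b y))"
      by (simp add: k_def algebra_simps sum_distrib_left sum_distrib_right)
    finally have "ennreal (2 * l * \<rho>\<^sup>2 * e x y) \<le> ennreal \<dots>" by (rule ennreal_leI)
    then show ?thesis
      unfolding ennreal_mult'[OF k, symmetric] using l(1) e' k
      by (simp add: ennreal_mult ennreal_plus sum_nonneg post_spread_nonneg flip: sum_ennreal)
  qed
  have "ennreal (2 * l * \<rho>\<^sup>2) = (\<integral>\<^sup>+ y. ennreal (2 * l * \<rho>\<^sup>2) * ennreal (e x y) \<partial>std_gaussian N)"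
    by (simp add: nn_integral_cmult int_e)
  also have "\<dots> \<le> (\<integral>\<^sup>+ y. (ennreal (post_spread N p s x y) * ennreal (e x y) + ennreal (\<rho>\<^sup>2 * l\<^sup>2) * ennreal (e x y) +
      (\<Sum>a\<in>A. \<Sum>b\<in>B. ennreal (k a b) * ennreal (e x y * e a y / e b y))) \<partial>std_gaussian N)"
    by (intro nn_integral_mono pointwise)
  also have "\<dots> = local_risk N p s x + ennreal (\<rho>\<^sup>2 * l\<^sup>2) +
      (\<Sum>a\<in>A. \<Sum>b\<in>B. ennreal (k a b) * (\<integral>\<^sup>+ y. ennreal (e x y * e a y / e b y) \<partial>std_gaussian N))"
    by (simp add: nn_integral_add nn_integral_sum nn_integral_cmult int_e local_risk_def e_def[symmetric])
  also have "\<dots> = local_risk N p s x + ennreal (\<rho>\<^sup>2 * l\<^sup>2) +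
      ennreal (\<Sum>a\<in>A. \<Sum>b\<in>B. k a b * exp (\<Sum>i<N. (s * b i - s * x i) * (s * b i - s * a i)))"
    unfolding e_def nn_integral_cm_density_quotient
    by (simp add: k ennreal_mult sum_nonneg flip: sum_ennreal)
  also have "\<dots> \<le> local_risk N p s x + ennreal (\<rho>\<^sup>2 * l\<^sup>2) + ennreal (\<rho>\<^sup>2 * l\<^sup>2 * m)"
  proof (intro add_left_mono ennreal_leI)
    have "(\<Sum>a\<in>A. \<Sum>b\<in>B. k a b * exp (\<Sum>i<N. (s * b i - s * x i) * (s * b i - s * a i))) \<le>
        (\<Sum>a\<in>A. \<Sum>b\<in>B. k a b * exp (2 * s\<^sup>2 * R\<^sup>2))"
      by (intro sum_mono mult_left_mono k) (auto intro!: inner_product_bound near)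
    also have "\<dots> = \<rho>\<^sup>2 * l\<^sup>2 * ((\<Sum>a\<in>A. pmf p a) * P * exp (2 * s\<^sup>2 * R\<^sup>2) / P\<^sup>2)"
    proof -
      have "(\<Sum>a\<in>A. \<Sum>b\<in>B. k a b * exp (2 * s\<^sup>2 * R\<^sup>2)) =
          (\<Sum>a\<in>A. \<Sum>b\<in>B. (\<rho>\<^sup>2 * l\<^sup>2 * exp (2 * s\<^sup>2 * R\<^sup>2) / P\<^sup>2) * (pmf p a * pmf p b))"
        by (intro sum.cong) (auto simp: k_def)
      also have "\<dots> = (\<rho>\<^sup>2 * l\<^sup>2 * exp (2 * s\<^sup>2 * R\<^sup>2) / P\<^sup>2) * ((\<Sum>a\<in>A. pmf p a) * P)"
        by (simp only: sum_distrib_left[symmetric] sum_product P_def)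
      finally show ?thesis by (simp add: mult_ac)
    qed
    also have "\<dots> = \<rho>\<^sup>2 * l\<^sup>2 * ((\<Sum>a\<in>A. pmf p a) * exp (2 * s\<^sup>2 * R\<^sup>2) / P)"
      using P by (simp add: power2_eq_square)
    also have "\<dots> \<le> \<rho>\<^sup>2 * l\<^sup>2 * m"
      using P odds by (intro mult_left_mono) (auto simp: P_def[symmetric] field_simps)
    finally show "(\<Sum>a\<in>A. \<Sum>b\<in>B. k a b * exp (\<Sum>i<N. (s * b i - s * x i) * (s * b i - s * a i))) \<le> \<rho>\<^sup>2 * l\<^sup>2 * m" .
  qed
  also have "\<dots> = local_risk N p s x + ennreal (\<rho>\<^sup>2 * (l\<^sup>2 * (1 + m)))"
    using \<open>m \<ge> 0\<close> by (simp add: add.assoc algebra_simps flip: ennreal_plus)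
  also have "\<dots> = ennreal (\<rho>\<^sup>2 * l) + local_risk N p s x"
    by (simp add: l add.commute)
  finally have "ennreal (2 * l * \<rho>\<^sup>2) - ennreal (\<rho>\<^sup>2 * l) \<le> local_risk N p s x"
    by (simp add: ennreal_minus_le_iff)
  moreover have "ennreal (2 * l * \<rho>\<^sup>2) - ennreal (\<rho>\<^sup>2 * l) = ennreal (\<rho>\<^sup>2 / (1 + m))"
  proof -
    have "2 * l * \<rho>\<^sup>2 - \<rho>\<^sup>2 * l = \<rho>\<^sup>2 / (1 + m)" by (simp add: l_def)
    then show ?thesis using l by (simp add: ennreal_minus)
  qed
  ultimately show ?thesis by simp
qed

section \<open>Integration over scales and noise levels\<close>

definition ball_mass :: "nat \<Rightarrow> (nat \<Rightarrow> real) pmf \<Rightarrow> (nat \<Rightarrow> real) \<Rightarrow> real \<Rightarrow> real" where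
  "ball_mass N p x r = measure_pmf.prob p {u. euc_dist N x u \<le> r}"

lemma euc_dist_self [simp]: "euc_dist N x x = 0"
  by (simp add: euc_dist_def L2_set_def)

lemma ball_mass_mono: "mono (ball_mass N p x)"
  unfolding ball_mass_def by (intro monoI measure_pmf.finite_measure_mono) auto

lemma measurable_ball_mass [measurable]: "ball_mass N p x \<in> borel_measurable borel"
  by (rule borel_measurable_mono[OF ball_mass_mono])

lemma ball_mass_ge: "r \<ge> 0 \<Longrightarrow> pmf p x \<le> ball_mass N p x r"
  unfolding ball_mass_def by (simp add: pmf.rep_eq) (rule measure_pmf.finite_measure_mono; auto)

lemma ball_mass_pos: "x \<in> set_pmf p \<Longrightarrow> r \<ge> 0 \<Longrightarrow> ball_mass N p x r > 0"
  using ball_mass_ge[of r p x N] pmf_positive[of x p] by simp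

lemma ball_mass_le_1: "ball_mass N p x r \<le> 1"
  by (simp add: ball_mass_def)

lemma measurable_local_risk [measurable]:
  "(\<lambda>s. local_risk N p s x) \<in> borel_measurable borel"
proof -
  interpret G: prob_space "std_gaussian N" by (rule prob_space_std_gaussian)
  show ?thesis
    unfolding local_risk_def post_spread_def post_weight_def cm_density_def by measurable
qed

definition log_gain :: "nat \<Rightarrow> (nat \<Rightarrow> real) pmf \<Rightarrow> (nat \<Rightarrow> real) \<Rightarrow> real \<Rightarrow> real" where
  "log_gain N p x r = ln (ball_mass N p x (2 * r) / ball_mass N p x r)"

lemma measurable_log_gain [measurable]: "log_gain N p x \<in> borel_measurable borel"
  unfolding log_gain_def[abs_def] by measurable

lemma log_gain_nonneg:
  assumes "x \<in> set_pmf p" "r \<ge> 0"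
  shows "log_gain N p x r \<ge> 0"
  unfolding log_gain_def using ball_mass_pos[of x p _ N] monoD[OF ball_mass_mono[of N p x], of r "2 * r"] assms
  by (intro ln_ge_zero) simp

text \<open>
Apply the preceding bound with \<open>A = B(x,r)\<close>, \<open>B\<close> the shell between the radii \<open>r\<close> and \<open>2r\<close>, and \<open>R = 2r\<close>. The
summand 1 in the hypothesis pays for passing from the ball of radius \<open>2r\<close> to the shell.
\<close>

lemma local_risk_ge_scale:
  assumes fin: "finite (set_pmf p)" and x: "x \<in> set_pmf p" and r: "r > 0"
    and gain: "log_gain N p x r \<ge> 1 + 8 * s\<^sup>2 * r\<^sup>2"
  shows "ennreal (r\<^sup>2 / 2) \<le> local_risk N p s x"
proof -
  let ?S = "set_pmf p"
  define A where "A = {u \<in> ?S. euc_dist N x u \<le> r}"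
  define B where "B = {u \<in> ?S. r < euc_dist N x u \<and> euc_dist N x u \<le> 2 * r}"
  have finA: "finite A" "finite B" using fin by (auto simp: A_def B_def)
  have mass: "ball_mass N p x t = (\<Sum>u | u \<in> ?S \<and> euc_dist N x u \<le> t. pmf p u)" for t
  proof -
    have "ball_mass N p x t = measure_pmf.prob p {u. u \<in> ?S \<and> euc_dist N x u \<le> t}"
      unfolding ball_mass_def by (rule measure_pmf.finite_measure_eq_AE) (auto simp: AE_measure_pmf_iff)
    then show ?thesis using fin by (simp add: measure_measure_pmf_finite)
  qed
  define a where "a = (\<Sum>u\<in>A. pmf p u)"
  define b where "b = (\<Sum>u\<in>B. pmf p u)"
  have a: "ball_mass N p x r = a" by (simp add: mass a_def A_def)
  have "{u. u \<in> ?S \<and> euc_dist N x u \<le> 2 * r} = A \<union> B"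
    using r by (auto simp: A_def B_def)
  then have ab: "ball_mass N p x (2 * r) = a + b"
    unfolding mass a_def b_def using finA by (simp, subst sum.union_disjoint) (auto simp: A_def B_def)
  have a_pos: "a > 0" using ball_mass_pos[OF x, of r N] r a by simp
  have b_nn: "b \<ge> 0" by (simp add: b_def sum_nonneg)
  define q where "q = exp (8 * s\<^sup>2 * r\<^sup>2)"
  have q: "q \<ge> 1" by (simp add: q_def)
  have "exp (1 + 8 * s\<^sup>2 * r\<^sup>2) \<le> (a + b) / a"
    using gain a_pos b_nn unfolding log_gain_def a ab by (subst (asm) ln_ge_iff) auto
  then have "exp 1 * q * a \<le> a + b" using a_pos by (simp add: exp_add q_def field_simps)
  moreover have "2 * q * a \<le> exp 1 * q * a"
    using q a_pos exp_ge_add_one_self[of "1::real"] by (intro mult_right_mono) auto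
  moreover have "a \<le> q * a" using q a_pos by simp
  ultimately have aq: "a * q \<le> b" by (simp add: mult_ac)
  then have "b > 0" using a_pos q by (smt (verit) mult_pos_pos)
  then have "B \<noteq> {}" by (auto simp: b_def)
  have "ennreal (r\<^sup>2 / (1 + 1)) \<le> local_risk N p s x"
    using aq by (intro local_risk_ge[OF fin, where A = A and B = B and R = "2 * r"] \<open>B \<noteq> {}\<close>)
      (use r in \<open>auto simp: A_def B_def a_def b_def q_def power_mult_distrib mult_ac\<close>)
  then show ?thesis by simp
qed

lemma nn_integral_id_Icc:
  assumes "c \<ge> 0"
  shows "(\<integral>\<^sup>+ r. ennreal r * indicator {0..c} r \<partial>lborel) = ennreal (c\<^sup>2 / 2)"
proof -
  have "(\<integral>\<^sup>+ r. ennreal r * indicator {0..c} r \<partial>lborel) = ennreal (c\<^sup>2 / 2 - 0\<^sup>2 / 2)"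
    using assms by (intro nn_integral_FTC_Icc) (auto intro!: derivative_eq_intros)
  then show ?thesis by simp
qed

text \<open>
Used with \<open>L\<close> the local risk: all the scales at which it is bounded below by \<open>r\<^sup>2 / 2\<close> can be
integrated at once, at no loss beyond a constant.
\<close>

lemma nn_integral_scales_le:
  fixes L :: ennreal
  shows "(\<integral>\<^sup>+ r. ennreal r * indicator {r. 0 < r \<and> ennreal (r\<^sup>2 / 2) \<le> L} r \<partial>lborel) \<le> L"
proof (cases L)
  case (real l)
  have "(\<integral>\<^sup>+ r. ennreal r * indicator {r. 0 < r \<and> ennreal (r\<^sup>2 / 2) \<le> L} r \<partial>lborel)
      \<le> (\<integral>\<^sup>+ r. ennreal r * indicator {0..sqrt (2 * l)} r \<partial>lborel)"
    using real by (intro nn_integral_mono) (auto simp: indicator_def intro!: real_le_rsqrt)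
  also have "\<dots> = L" using real by (subst nn_integral_id_Icc) auto
  finally show ?thesis .
qed auto

text \<open>
With \<open>L(r) = ln (1 / \<pi>(B(x,r)))\<close> and \<open>m(r) = L(r) - L(2r)\<close>, subadditivity of the square root gives
\<open>\<integral> sqrt (L(r)) dr \<le> \<integral> sqrt (L(2r)) dr + \<integral> sqrt (m(r)) dr\<close>. The first term on the right is half of the left side,
because \<open>L\<close> vanishes beyond \<open>D\<close>. In the second, \<open>sqrt (m(r))\<close> is at most \<open>1 + 3 r \<sigma>(r)\<close>, where the scale
\<open>r\<close> contributes to the local risk for every \<open>s < \<sigma>(r)\<close>; writing \<open>\<sigma>(r)\<close> as an integral over \<open>s\<close> and
exchanging the integrals yields the local risk.
\<close>

theorem entropy_integral_le_local_risk:
  assumes fin: "finite (set_pmf p)" and x: "x \<in> set_pmf p" and D: "D > 0"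
    and all: "ball_mass N p x D = 1"
  shows "(\<integral>\<^sup>+ r\<in>{0..D}. ennreal (sqrt (ln (1 / ball_mass N p x r))) \<partial>lborel)
    \<le> ennreal (2 * D) + 6 * (\<integral>\<^sup>+ s\<in>{0..}. local_risk N p s x \<partial>lborel)"
proof -
  let ?b = "ball_mass N p x" and ?m = "log_gain N p x"
  define F where "F r = ennreal (sqrt (ln (1 / ?b r))) * indicator {0..D} r" for r
  define J where "J = (\<integral>\<^sup>+ r\<in>{0..D}. ennreal (sqrt (?m r)) \<partial>lborel)"
  define I where "I = (\<integral>\<^sup>+ r. F r \<partial>lborel)"
  have [measurable]: "F \<in> borel_measurable borel" unfolding F_def[abs_def] by measurable
  have one: "?b r = 1" if "r \<ge> D" for r
    using all monoD[OF ball_mass_mono[of N p x] that] ball_mass_le_1[of N p x r] by simp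
  have pos: "?b r > 0" if "r \<ge> 0" for r using ball_mass_pos[OF x that] .
  have split: "F r \<le> F (2 * r) + ennreal (sqrt (?m r)) * indicator {0..D} r" for r
  proof (cases "r \<in> {0..D}")
    case True
    then have p: "?b r > 0" "?b (2 * r) > 0" by (auto intro!: pos)
    have "ln (1 / ?b r) = ln (1 / ?b (2 * r)) + ?m r"
      using p by (simp add: log_gain_def ln_div)
    moreover have "ln (1 / ?b (2 * r)) \<ge> 0"
      using p ball_mass_le_1[of N p x "2 * r"] by (intro ln_ge_zero) simp
    moreover have "?m r \<ge> 0" using True x by (intro log_gain_nonneg) auto
    ultimately have "sqrt (ln (1 / ?b r)) \<le> sqrt (ln (1 / ?b (2 * r))) + sqrt (?m r)"
      by (simp add: sqrt_add_le_add_sqrt)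
    then have "ennreal (sqrt (ln (1 / ?b r))) \<le> ennreal (sqrt (ln (1 / ?b (2 * r)))) + ennreal (sqrt (?m r))"
      using \<open>?m r \<ge> 0\<close> \<open>ln (1 / ?b (2 * r)) \<ge> 0\<close> by (simp add: ennreal_leI flip: ennreal_plus)
    then show ?thesis
      using True one[of "2 * r"] by (cases "2 * r \<le> D") (auto simp: F_def)
  qed (simp add: F_def)
  have "I \<le> (\<integral>\<^sup>+ r. F (2 * r) \<partial>lborel) + J"
    unfolding I_def J_def by (subst nn_integral_add[symmetric]) (auto intro!: nn_integral_mono split)
  moreover have "I = 2 * (\<integral>\<^sup>+ r. F (2 * r) \<partial>lborel)"
    unfolding I_def by (subst nn_integral_real_affine[where c = 2 and t = 0]) auto
  \<comment> \<open>Finiteness is needed to absorb half of \<open>I\<close> into the left side.\<close>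
  moreover have "I < \<infinity>"
  proof -
    have "I \<le> (\<integral>\<^sup>+ r. ennreal (sqrt (ln (1 / pmf p x))) * indicator {0..D} r \<partial>lborel)"
      unfolding I_def F_def using pmf_positive[OF x] ball_mass_ge[of _ p x N]
      by (intro nn_integral_mono) (auto simp: indicator_def intro!: ennreal_leI frac_le ln_mono pos)
    also have "\<dots> < \<infinity>" using D by (simp add: nn_integral_cmult_indicator ennreal_mult_less_top)
    finally show ?thesis .
  qed
  ultimately have IJ: "I \<le> 2 * J"
  proof -
    define H where "H = (\<integral>\<^sup>+ r. F (2 * r) \<partial>lborel)"
    assume "I \<le> (\<integral>\<^sup>+ r. F (2 * r) \<partial>lborel) + J" "I = 2 * (\<integral>\<^sup>+ r. F (2 * r) \<partial>lborel)" "I < \<infinity>"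
    then have H: "H + H \<le> H + J" "H < \<infinity>" "I = 2 * H"
      unfolding H_def[symmetric] by (auto simp: mult_2 ennreal_mult_less_top)
    then have "H \<le> J" by (auto simp: ennreal_add_left_cancel_le)
    then show ?thesis using H by (simp add: mult_left_mono)
  qed
  \<comment> \<open>The largest \<open>s\<close> with \<open>1 + 8 s\<^sup>2 r\<^sup>2 \<le> m(r)\<close>, or 0 if there is none.\<close>
  define sc where "sc r = sqrt (max 0 (?m r - 1) / 8) / r" for r
  have [measurable]: "sc \<in> borel_measurable borel" unfolding sc_def[abs_def] by measurable
  define K where "K r s = ennreal r * indicator {0<..D} r * indicator {0..<sc r} s" for r s
  have K_meas [measurable]: "(\<lambda>(r, s). K r s) \<in> borel_measurable (borel \<Otimes>\<^sub>M borel)"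
  proof -
    have "(\<lambda>(r, s). K r s) = (\<lambda>(r, s). ennreal r * indicator {0<..D} r * (if 0 \<le> s \<and> s < sc r then 1 else 0))"
      by (auto simp: K_def fun_eq_iff indicator_def)
    then show ?thesis by (simp) measurable
  qed
  have "ennreal (sqrt (?m r)) * indicator {0..D} r \<le>
      indicator {0..D} r + 3 * (\<integral>\<^sup>+ s. K r s \<partial>lborel)" if "r \<noteq> 0" for r
  proof (cases "r \<in> {0<..D}")
    case True
    then have m: "?m r \<ge> 0" using x by (intro log_gain_nonneg) auto
    have sc: "sc r \<ge> 0" using True by (simp add: sc_def)
    have "?m r \<le> 1 + max 0 (?m r - 1)" by simp
    then have "sqrt (?m r) \<le> sqrt 1 + sqrt (max 0 (?m r - 1))"
      by (smt (verit) real_sqrt_le_mono sqrt_add_le_add_sqrt)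
    also have "sqrt (max 0 (?m r - 1)) = sqrt 8 * (r * sc r)"
      using True by (simp add: sc_def real_sqrt_divide)
    also have "sqrt 8 * (r * sc r) \<le> 3 * (r * sc r)"
      using True sc by (intro mult_right_mono real_le_lsqrt) auto
    finally have "ennreal (sqrt (?m r)) \<le> ennreal (1 + 3 * (r * sc r))" by (simp add: ennreal_leI)
    also have "\<dots> = 1 + 3 * (ennreal r * ennreal (sc r))"
      using True sc by (simp add: ennreal_plus ennreal_mult)
    also have "ennreal r * ennreal (sc r) = (\<integral>\<^sup>+ s. K r s \<partial>lborel)"
      unfolding K_def using True sc by (simp add: nn_integral_cmult_indicator)
    finally show ?thesis using True by simp
  qed (use that in auto)
  then have "J \<le> (\<integral>\<^sup>+ r. (indicator {0..D} r + 3 * (\<integral>\<^sup>+ s. K r s \<partial>lborel)) \<partial>lborel)"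
    unfolding J_def by (intro nn_integral_mono_AE) (auto intro: AE_mp[OF AE_lborel_singleton[of 0]])
  also have "\<dots> = ennreal D + 3 * (\<integral>\<^sup>+ r. \<integral>\<^sup>+ s. K r s \<partial>lborel \<partial>lborel)"
    using D by (simp add: nn_integral_add nn_integral_cmult)
  also have "(\<integral>\<^sup>+ r. \<integral>\<^sup>+ s. K r s \<partial>lborel \<partial>lborel) = (\<integral>\<^sup>+ s. \<integral>\<^sup>+ r. K r s \<partial>lborel \<partial>lborel)"
    using K_meas by (intro lborel_pair.Fubini') simp
  also have "\<dots> \<le> (\<integral>\<^sup>+ s\<in>{0..}. local_risk N p s x \<partial>lborel)"
  proof (intro nn_integral_mono)
    fix s :: real
    show "(\<integral>\<^sup>+ r. K r s \<partial>lborel) \<le> local_risk N p s x * indicator {0..} s"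
    proof (cases "s \<ge> 0")
      case True
      have "K r s \<le> ennreal r * indicator {r. 0 < r \<and> ennreal (r\<^sup>2 / 2) \<le> local_risk N p s x} r" for r
      proof (cases "0 < r \<and> s < sc r")
        case r: True
        have "sc r > 0" using r True by simp
        have m: "?m r > 1"
        proof (rule ccontr)
          assume "\<not> ?m r > 1"
          then have "sc r = 0" by (simp add: sc_def max_def)
          with \<open>sc r > 0\<close> show False by simp
        qed
        have "(s * r)\<^sup>2 \<le> (sc r * r)\<^sup>2" using r True by (intro power_mono mult_right_mono) auto
        also have "\<dots> = (?m r - 1) / 8" using r m by (simp add: sc_def)
        finally have "1 + 8 * s\<^sup>2 * r\<^sup>2 \<le> ?m r" by (simp add: power_mult_distrib)
        then show ?thesis
          using local_risk_ge_scale[OF fin x] r by (auto simp: K_def indicator_def)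
      qed (auto simp: K_def indicator_def)
      then have "(\<integral>\<^sup>+ r. K r s \<partial>lborel) \<le> local_risk N p s x"
        by (intro order.trans[OF nn_integral_mono nn_integral_scales_le])
      then show ?thesis using True by simp
    qed (simp add: K_def)
  qed
  finally have "J \<le> ennreal D + 3 * (\<integral>\<^sup>+ s\<in>{0..}. local_risk N p s x \<partial>lborel)"
    by (simp add: mult_left_mono add_left_mono)
  then have "2 * J \<le> 2 * (ennreal D + 3 * (\<integral>\<^sup>+ s\<in>{0..}. local_risk N p s x \<partial>lborel))"
    by (intro mult_left_mono) auto
  also have "\<dots> = ennreal (2 * D) + 6 * (\<integral>\<^sup>+ s\<in>{0..}. local_risk N p s x \<partial>lborel)"
    using D by (simp add: distrib_left ennreal_mult mult.assoc[symmetric])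
  finally show ?thesis using IJ unfolding I_def F_def by (rule order.trans[rotated])
qed

section \<open>Multiplicative weights in self-play\<close>

definition prob_weights :: "'a set \<Rightarrow> ('a \<Rightarrow> real) \<Rightarrow> bool" where
  "prob_weights T w \<longleftrightarrow> (\<forall>t\<in>T. w t \<ge> 0) \<and> sum w T = 1"

definition softmax :: "'a set \<Rightarrow> real \<Rightarrow> ('a \<Rightarrow> real) \<Rightarrow> 'a \<Rightarrow> real" where
  "softmax T \<eta> g t = exp (\<eta> * g t) / (\<Sum>u\<in>T. exp (\<eta> * g u))"

text \<open>
The accumulated payoffs of all points when the multiplicative weights strategy is played in both roles: in
each round every point \<open>t\<close> gains \<open>K w t\<close>, where \<open>w\<close> are the current weights.
\<close>

primrec mw_gain :: "('a set \<Rightarrow> real \<Rightarrow> (('a \<Rightarrow> real) \<Rightarrow> 'a \<Rightarrow> real) \<Rightarrow> nat \<Rightarrow> 'a \<Rightarrow> real)" where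
  "mw_gain T \<eta> K 0 = (\<lambda>t. 0)"
| "mw_gain T \<eta> K (Suc n) = (\<lambda>t. mw_gain T \<eta> K n t + K (softmax T \<eta> (mw_gain T \<eta> K n)) t)"

lemma prob_weights_softmax:
  assumes "finite T" "T \<noteq> {}"
  shows "prob_weights T (softmax T \<eta> g)"
proof -
  have "(\<Sum>u\<in>T. exp (\<eta> * g u)) > 0" using assms by (intro sum_pos) auto
  then show ?thesis
    by (simp add: prob_weights_def softmax_def sum_divide_distrib[symmetric])
qed

text \<open>
The regret bound of multiplicative weights. The potential \<open>W n = \<Sum>t. exp (\<eta> G n t)\<close> grows in each round by at
most the factor \<open>exp (\<eta> a + \<eta>\<^sup>2 C\<^sup>2)\<close>, where \<open>a\<close> is the average payoff of that round, so for long play no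
point gains much more than the sum of the average payoffs. By convexity the mean \<open>\<nu>\<close> of the weights
then satisfies the claim, with \<open>w\<close> the weights of the round of largest average payoff.
\<close>

lemma self_play:
  fixes K :: "('a \<Rightarrow> real) \<Rightarrow> 'a \<Rightarrow> real"
  assumes fin: "finite T" "T \<noteq> {}"
    and bound: "\<And>w t. prob_weights T w \<Longrightarrow> t \<in> T \<Longrightarrow> 0 \<le> K w t \<and> K w t \<le> B"
    and conv: "\<And>n ws t. n > 0 \<Longrightarrow> (\<And>j. prob_weights T (ws j)) \<Longrightarrow> t \<in> T \<Longrightarrow>
       K (\<lambda>u. (\<Sum>j<n. ws j u) / real n) t \<le> (\<Sum>j<n. K (ws j) t) / real n"
    and eps: "\<epsilon> > 0"
  shows "\<exists>w \<nu>. prob_weights T w \<and> prob_weights T \<nu> \<and>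
    (\<forall>t\<in>T. K \<nu> t \<le> (\<Sum>u\<in>T. w u * K w u) + \<epsilon>)"
proof -
  define C where "C = max B 1"
  have C: "C \<ge> 1" "\<And>w t. prob_weights T w \<Longrightarrow> t \<in> T \<Longrightarrow> K w t \<le> C"
    using bound by (auto simp: C_def max_def intro: order.trans)
  \<comment> \<open>Over \<open>n\<close> rounds the regret is \<open>ln (card T) / \<eta> + n \<eta> C\<^sup>2\<close>; this step size makes the second term at most \<open>n \<epsilon> / 2\<close>.\<close>
  define \<eta> where "\<eta> = min (1 / C) (\<epsilon> / (2 * C\<^sup>2))"
  have \<eta>: "\<eta> > 0" "\<eta> * C \<le> 1" "\<eta> * C\<^sup>2 \<le> \<epsilon> / 2"
    using C(1) eps by (auto simp: \<eta>_def min_def field_simps power2_eq_square)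
  define G where "G = mw_gain T \<eta> K"
  define ws where "ws j = softmax T \<eta> (G j)" for j
  define W where "W j = (\<Sum>t\<in>T. exp (\<eta> * G j t))" for j
  define a where "a j = (\<Sum>t\<in>T. ws j t * K (ws j) t)" for j
  have ws: "prob_weights T (ws j)" for j unfolding ws_def by (rule prob_weights_softmax[OF fin])
  have W: "W j > 0" for j unfolding W_def using fin by (intro sum_pos) auto
  have G: "G n t = (\<Sum>j<n. K (ws j) t)" for n t
    by (induction n) (auto simp: G_def ws_def)
  have W_Suc: "W (Suc j) \<le> W j * exp (\<eta> * a j + \<eta> * (\<eta> * C\<^sup>2))" for j
  proof -
    have "W (Suc j) = W j * (\<Sum>t\<in>T. ws j t * exp (\<eta> * K (ws j) t))"
      using W[of j] by (simp add: W_def G exp_add distrib_left ws_def softmax_def sum_distrib_left)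
    also have "\<dots> \<le> W j * (\<Sum>t\<in>T. ws j t * (1 + \<eta> * K (ws j) t + (\<eta> * C)\<^sup>2))"
    proof (intro mult_left_mono sum_mono)
      fix t assume t: "t \<in> T"
      then have k: "0 \<le> K (ws j) t" "K (ws j) t \<le> C" using bound ws C by auto
      have le: "\<eta> * K (ws j) t \<le> \<eta> * C" using k \<eta> by simp
      then have "(\<eta> * K (ws j) t)\<^sup>2 \<le> (\<eta> * C)\<^sup>2" using \<eta> k by (intro power_mono) auto
      moreover have "exp (\<eta> * K (ws j) t) \<le> 1 + \<eta> * K (ws j) t + (\<eta> * K (ws j) t)\<^sup>2"
        using le \<eta> k by (intro exp_bound mult_nonneg_nonneg) linarith+
      ultimately show "exp (\<eta> * K (ws j) t) \<le> 1 + \<eta> * K (ws j) t + (\<eta> * C)\<^sup>2"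
        by linarith
    qed (use ws W in \<open>auto simp: prob_weights_def less_imp_le\<close>)
    also have "(\<Sum>t\<in>T. ws j t * (1 + \<eta> * K (ws j) t + (\<eta> * C)\<^sup>2)) = 1 + (\<eta> * a j + \<eta> * (\<eta> * C\<^sup>2))"
    proof -
      have "(\<Sum>t\<in>T. ws j t * (1 + \<eta> * K (ws j) t + (\<eta> * C)\<^sup>2)) =
          sum (ws j) T * (1 + (\<eta> * C)\<^sup>2) + \<eta> * a j"
        unfolding a_def sum_distrib_left sum_distrib_right sum.distrib[symmetric]
        by (intro sum.cong) (auto simp: algebra_simps)
      then show ?thesis using ws[of j] by (simp add: prob_weights_def power2_eq_square)
    qed
    also have "\<dots> \<le> exp (\<eta> * a j + \<eta> * (\<eta> * C\<^sup>2))" by (rule exp_ge_add_one_self)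
    finally show ?thesis using W[of j] by (simp add: mult_left_mono)
  qed
  have W_n: "W n \<le> card T * exp (\<eta> * (\<Sum>j<n. a j) + real n * (\<eta> * (\<eta> * C\<^sup>2)))" for n
  proof (induction n)
    case (Suc n)
    have "W (Suc n) \<le> W n * exp (\<eta> * a n + \<eta> * (\<eta> * C\<^sup>2))" by (rule W_Suc)
    also have "\<dots> \<le> (card T * exp (\<eta> * (\<Sum>j<n. a j) + real n * (\<eta> * (\<eta> * C\<^sup>2)))) * exp (\<eta> * a n + \<eta> * (\<eta> * C\<^sup>2))"
      by (intro mult_right_mono Suc) auto
    finally show ?case by (simp add: exp_add[symmetric] mult.assoc) (simp add: algebra_simps)
  qed (simp add: W_def G)
  have card: "card T > 0" using fin by (simp add: card_gt_0_iff)
  obtain n :: nat where n: "n > 2 * ln (card T) / (\<eta> * \<epsilon>)" "n > 0"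
    by (metis gr0I less_trans of_nat_0_less_iff reals_Archimedean2 zero_less_one max_less_iff_conj)
  have "finite (a ` {..<n})" "a ` {..<n} \<noteq> {}" using n by auto
  then obtain j where j: "\<And>i. i < n \<Longrightarrow> a i \<le> a j"
    using Max_in[of "a ` {..<n}"] Max_ge[of "a ` {..<n}"] by (metis (no_types, lifting) image_eqI image_iff lessThan_iff)
  show ?thesis
  proof (rule exI[of _ "ws j"], rule exI[of _ "\<lambda>u. (\<Sum>j<n. ws j u) / real n"], intro conjI ballI)
    show "prob_weights T (\<lambda>u. (\<Sum>j<n. ws j u) / real n)"
      using ws n unfolding prob_weights_def sum_divide_distrib[symmetric]
      by (subst sum.swap) (auto intro!: divide_nonneg_nonneg sum_nonneg)
    fix t assume t: "t \<in> T"
    have "exp (\<eta> * G n t) \<le> W n"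
      unfolding W_def using fin t by (intro member_le_sum) auto
    also note W_n[of n]
    finally have "ln (exp (\<eta> * G n t)) \<le> ln (card T * exp (\<eta> * (\<Sum>j<n. a j) + real n * (\<eta> * (\<eta> * C\<^sup>2))))"
      by (intro ln_mono) auto
    then have "\<eta> * G n t \<le> ln (card T) + (\<eta> * (\<Sum>j<n. a j) + real n * (\<eta> * (\<eta> * C\<^sup>2)))"
      using card by (simp add: ln_mult)
    also have "ln (card T) \<le> \<eta> * (n * (\<epsilon> / 2))"
      using n \<eta> eps by (simp add: field_simps)
    also have "real n * (\<eta> * (\<eta> * C\<^sup>2)) \<le> \<eta> * (n * (\<epsilon> / 2))"
      using mult_left_mono[OF \<eta>(3), of "\<eta> * n"] \<eta>(1) by (simp add: mult_ac)
    also have "(\<Sum>j<n. a j) \<le> n * a j"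
      using j by (intro order.trans[OF sum_bounded_above[of _ _ "a j"]]) auto
    finally have "\<eta> * G n t \<le> \<eta> * (n * (a j + \<epsilon>))"
      using \<eta> by (simp add: algebra_simps mult_left_mono)
    then have "G n t \<le> n * (a j + \<epsilon>)" using \<eta>(1) by simp
    then have "G n t / n \<le> a j + \<epsilon>" using n by (simp add: field_simps)
    moreover have "K (\<lambda>u. (\<Sum>j<n. ws j u) / real n) t \<le> G n t / n"
      unfolding G using n ws t by (intro conv) auto
    ultimately show "K (\<lambda>u. (\<Sum>j<n. ws j u) / real n) t \<le> (\<Sum>u\<in>T. ws j u * K (ws j) u) + \<epsilon>"
      by (simp add: a_def)
  qed (rule ws)
qed

text \<open>
The function \<open>sqrt (ln (1 / x))\<close> itself is convex only on \<open>(0, exp (- 1 / 2)]\<close>; adding 1 to the logarithm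
moves the inflection point beyond 1.
\<close>

lemma convex_on_sqrt_log: "convex_on {0<..1} (\<lambda>x::real. sqrt (1 - ln x))"
proof (rule f''_ge0_imp_convex)
  fix x :: real assume "x \<in> {0<..1}"
  then have x1: "x > 0" and l: "ln x \<le> 0" by auto
  have ne: "ln x \<noteq> 1" "\<not> 1 < ln x" using l by linarith+
  have s: "sqrt (1 - ln x) \<ge> 1" "sqrt (1 - ln x) > 0"
    using l ne by (auto simp del: ln_le_zero_iff)
  show "((\<lambda>x. sqrt (1 - ln x)) has_real_derivative - 1 / (2 * (x * sqrt (1 - ln x)))) (at x)"
    using x1 by (auto intro!: derivative_eq_intros simp: ne field_simps)
  show "((\<lambda>x. - 1 / (2 * (x * sqrt (1 - ln x)))) has_real_derivative
      (sqrt (1 - ln x) - 1 / (2 * sqrt (1 - ln x))) / (2 * (x * sqrt (1 - ln x))\<^sup>2)) (at x)"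
    using x1 s(2) by (auto intro!: derivative_eq_intros simp: ne field_simps power2_eq_square)
  have "1 / (2 * sqrt (1 - ln x)) \<le> 1 / 2"
    using s by (intro frac_le) auto
  then have "1 / (2 * sqrt (1 - ln x)) \<le> sqrt (1 - ln x)" using s(1) by linarith
  then show "(sqrt (1 - ln x) - 1 / (2 * sqrt (1 - ln x))) / (2 * (x * sqrt (1 - ln x))\<^sup>2) \<ge> 0"
    by simp
qed simp

section \<open>A law with large average entropy integral\<close>

lemma pmf_of_weights:
  assumes "finite T" "prob_weights T w"
  shows "\<exists>p. set_pmf p \<subseteq> T \<and> (\<forall>u\<in>T. pmf p u = w u)"
proof -
  define f where "f u = (if u \<in> T then w u else 0)" for u
  have nn: "f u \<ge> 0" for u using assms by (auto simp: f_def prob_weights_def)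
  have "(\<integral>\<^sup>+ u. ennreal (f u) \<partial>count_space UNIV) = (\<Sum>u\<in>T. ennreal (f u))"
    using assms by (intro nn_integral_count_space') (auto simp: f_def)
  also have "\<dots> = ennreal (sum w T)"
    using assms nn by (subst sum_ennreal) (auto simp: f_def prob_weights_def intro!: sum.cong)
  finally have *: "pmf (embed_pmf f) u = f u" for u
    using assms nn by (intro pmf_embed_pmf) (auto simp: prob_weights_def)
  show ?thesis
    by (rule exI[of _ "embed_pmf f"]) (auto simp: * set_pmf_eq f_def split: if_splits)
qed

text \<open>
The mass of the ball \<open>B(t,r)\<close> under the even mixture of \<open>w\<close> and the uniform law on \<open>T\<close>. The uniform part
keeps the entropy bounded; the part \<open>w / 2\<close> ensures that little is lost against \<open>w\<close>.
\<close>

definition half_mass :: "'a set \<Rightarrow> ('a \<Rightarrow> 'a \<Rightarrow> real) \<Rightarrow> ('a \<Rightarrow> real) \<Rightarrow> 'a \<Rightarrow> real \<Rightarrow> real" where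
  "half_mass T d w t r = (\<Sum>u\<in>T. (w u + 1 / card T) / 2 * indicator {d t u..} r)"

lemma measurable_half_mass [measurable]: "half_mass T d w t \<in> borel_measurable borel"
  unfolding half_mass_def[abs_def] by measurable

lemma half_mass_bounds:
  assumes fin: "finite T" and t: "t \<in> T" and w: "prob_weights T w" and r: "d t t \<le> r"
  shows "half_mass T d w t r \<le> 1" "1 / (2 * card T) \<le> half_mass T d w t r"
    "(\<Sum>u | u \<in> T \<and> d t u \<le> r. w u) / 2 \<le> half_mass T d w t r"
proof -
  have card: "card T > 0" using fin t by (auto simp: card_gt_0_iff)
  have w0: "w u \<ge> 0" if "u \<in> T" for u using w that by (simp add: prob_weights_def)
  have "half_mass T d w t r \<le> (\<Sum>u\<in>T. (w u + 1 / card T) / 2)"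
    unfolding half_mass_def using w0 by (intro sum_mono) (auto simp: indicator_def add_nonneg_nonneg)
  also have "\<dots> = 1"
    using w card by (simp add: sum_divide_distrib[symmetric] sum.distrib prob_weights_def)
  finally show "half_mass T d w t r \<le> 1" .
  have "1 / (2 * card T) \<le> (w t + 1 / card T) / 2 * indicator {d t t..} r"
    using w0[OF t] r by (simp add: field_simps)
  also have "\<dots> \<le> half_mass T d w t r"
    unfolding half_mass_def using fin t w0 by (intro member_le_sum) (auto simp: indicator_def)
  finally show "1 / (2 * card T) \<le> half_mass T d w t r" .
  have "(\<Sum>u | u \<in> T \<and> d t u \<le> r. w u) / 2 = (\<Sum>u\<in>T. w u / 2 * indicator {d t u..} r)"
    unfolding sum_divide_distrib sum.inter_filter[OF fin] by (intro sum.cong) (auto simp: indicator_def)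
  also have "\<dots> \<le> half_mass T d w t r"
    unfolding half_mass_def by (intro sum_mono mult_right_mono) auto
  finally show "(\<Sum>u | u \<in> T \<and> d t u \<le> r. w u) / 2 \<le> half_mass T d w t r" .
qed

definition half_entropy :: "'a set \<Rightarrow> ('a \<Rightarrow> 'a \<Rightarrow> real) \<Rightarrow> real \<Rightarrow> ('a \<Rightarrow> real) \<Rightarrow> 'a \<Rightarrow> real" where
  "half_entropy T d D w t = (\<integral>r. indicator {0..D} r * sqrt (1 - ln (half_mass T d w t r)) \<partial>lborel)"

locale finite_dist =
  fixes T :: "'a set" and d :: "'a \<Rightarrow> 'a \<Rightarrow> real" and D :: real
  assumes fin: "finite T" and self: "\<And>t. d t t = 0" and D: "D > 0"
begin

abbreviation "integrand w t r \<equiv> indicator {0..D} r * sqrt (1 - ln (half_mass T d w t r))"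

lemma integrand_bounds:
  assumes "prob_weights T w" "t \<in> T"
  shows "0 \<le> integrand w t r" "integrand w t r \<le> sqrt (1 + ln (2 * card T)) * indicator {0..D} r"
proof -
  have card: "card T > 0" using fin assms by (auto simp: card_gt_0_iff)
  have "0 \<le> integrand w t r \<and> integrand w t r \<le> sqrt (1 + ln (2 * card T)) * indicator {0..D} r"
  proof (cases "r \<in> {0..D}")
    case True
    then have b: "half_mass T d w t r \<le> 1" "1 / (2 * card T) \<le> half_mass T d w t r"
      using half_mass_bounds[OF fin assms(2,1), of d r] self by auto
    have "0 < 1 / (2 * real (card T))" using card by simp
    then have pos: "half_mass T d w t r > 0" using b by linarith
    then have "ln (half_mass T d w t r) \<le> 0" using b by simp
    moreover have "ln (1 / (2 * card T)) \<le> ln (half_mass T d w t r)"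
      using b card by (intro ln_mono) auto
    ultimately show ?thesis using True card by (simp add: ln_div)
  qed simp
  then show "0 \<le> integrand w t r" "integrand w t r \<le> sqrt (1 + ln (2 * card T)) * indicator {0..D} r"
    by auto
qed

lemma integrable_bound: "integrable lborel (\<lambda>r. c * indicator {0..D} r :: real)"
  using D by (intro integrable_mult_right integrable_real_indicator) auto

lemma integrable_integrand:
  assumes "prob_weights T w" "t \<in> T"
  shows "integrable lborel (integrand w t)"
  using integrand_bounds[OF assms]
  by (intro Bochner_Integration.integrable_bound[OF integrable_bound[of "sqrt (1 + ln (2 * card T))"]])
     (auto intro!: AE_I2 simp del: real_sqrt_ge_0_iff intro: order.trans[OF _ abs_ge_self])

lemma half_entropy_nonneg:
  assumes "prob_weights T w" "t \<in> T"
  shows "0 \<le> half_entropy T d D w t"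
  unfolding half_entropy_def by (intro integral_nonneg_AE AE_I2 integrand_bounds assms)

lemma half_entropy_le:
  assumes "prob_weights T w" "t \<in> T"
  shows "half_entropy T d D w t \<le> D * sqrt (1 + ln (2 * card T))"
proof -
  have "half_entropy T d D w t \<le> (\<integral>r. sqrt (1 + ln (2 * card T)) * indicator {0..D} r \<partial>lborel)"
    unfolding half_entropy_def
    by (intro integral_mono integrable_integrand integrable_bound integrand_bounds assms)
  then show ?thesis using D by (simp add: mult.commute)
qed

lemma half_entropy_convex:
  assumes n: "n > 0" and ws: "\<And>j. prob_weights T (ws j)" and t: "t \<in> T"
  shows "half_entropy T d D (\<lambda>u. (\<Sum>j<n. ws j u) / real n) t \<le> (\<Sum>j<n. half_entropy T d D (ws j) t) / real n"
proof -
  have avg: "prob_weights T (\<lambda>u. (\<Sum>j<n. ws j u) / real n)"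
    using ws n unfolding prob_weights_def sum_divide_distrib[symmetric]
    by (subst sum.swap) (auto intro!: divide_nonneg_nonneg sum_nonneg)
  have lin: "half_mass T d (\<lambda>u. (\<Sum>j<n. ws j u) / real n) t r = (\<Sum>j<n. (1 / n) *\<^sub>R half_mass T d (ws j) t r)" for r
  proof -
    have "(\<Sum>j<n. (1 / n) *\<^sub>R half_mass T d (ws j) t r) =
        (\<Sum>u\<in>T. \<Sum>j<n. (1 / n) * ((ws j u + 1 / card T) / 2 * indicator {d t u..} r))"
      unfolding half_mass_def by (simp add: sum_distrib_left) (rule sum.swap)
    also have "\<dots> = half_mass T d (\<lambda>u. (\<Sum>j<n. ws j u) / real n) t r"
      unfolding half_mass_def
    proof (intro sum.cong refl)
      fix u
      have "(\<Sum>j<n. (1 / n) * ((ws j u + 1 / card T) / 2 * indicator {d t u..} r)) =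
          (1 / n) * ((\<Sum>j<n. ws j u) + n * (1 / card T)) / 2 * indicator {d t u..} r"
        by (simp add: sum_distrib_left[symmetric] sum_distrib_right[symmetric] sum.distrib sum_divide_distrib[symmetric])
      then show "(\<Sum>j<n. (1 / n) * ((ws j u + 1 / card T) / 2 * indicator {d t u..} r)) =
          ((\<Sum>j<n. ws j u) / real n + 1 / card T) / 2 * indicator {d t u..} r"
        using n by (simp add: field_simps)
    qed
    finally show ?thesis ..
  qed
  have "half_entropy T d D (\<lambda>u. (\<Sum>j<n. ws j u) / real n) t \<le>
      (\<integral>r. (\<Sum>j<n. (1 / n) * integrand (ws j) t r) \<partial>lborel)"
    unfolding half_entropy_def
  proof (intro integral_mono integrable_integrand avg t Bochner_Integration.integrable_sum integrable_mult_right ws)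
    fix r
    show "integrand (\<lambda>u. (\<Sum>j<n. ws j u) / real n) t r \<le> (\<Sum>j<n. (1 / n) * integrand (ws j) t r)"
    proof (cases "r \<in> {0..D}")
      case True
      have "half_mass T d (ws j) t r \<in> {0<..1}" for j
      proof -
        have "0 < 1 / (2 * real (card T))" using fin t by (auto simp: card_gt_0_iff)
        also have "\<dots> \<le> half_mass T d (ws j) t r"
          using half_mass_bounds(2)[OF fin t ws, of d r j] self True by simp
        finally show ?thesis
          using half_mass_bounds(1)[OF fin t ws, of d r j] self True by simp
      qed
      then have "sqrt (1 - ln (\<Sum>j<n. (1 / n) *\<^sub>R half_mass T d (ws j) t r)) \<le>
          (\<Sum>j<n. (1 / n) * sqrt (1 - ln (half_mass T d (ws j) t r)))"
        using n by (intro convex_on_sum[OF _ _ convex_on_sqrt_log]) auto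
      then show ?thesis using True by (simp add: lin)
    qed simp
  qed
  also have "\<dots> = (\<Sum>j<n. half_entropy T d D (ws j) t) / real n"
    unfolding half_entropy_def
    by (subst Bochner_Integration.integral_sum)
       (auto intro!: integrable_mult_right integrable_integrand ws t sum.cong simp: sum_divide_distrib)
  finally show ?thesis .
qed

lemma nn_half_entropy:
  assumes "prob_weights T w" "t \<in> T"
  shows "ennreal (half_entropy T d D w t) =
    (\<integral>\<^sup>+ r\<in>{0..D}. ennreal (sqrt (1 - ln (half_mass T d w t r))) \<partial>lborel)"
proof -
  have "ennreal (half_entropy T d D w t) = (\<integral>\<^sup>+ r. ennreal (integrand w t r) \<partial>lborel)"
    unfolding half_entropy_def
    by (intro nn_integral_eq_integral[symmetric] integrable_integrand assms AE_I2 integrand_bounds)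
  also have "\<dots> = (\<integral>\<^sup>+ r\<in>{0..D}. ennreal (sqrt (1 - ln (half_mass T d w t r))) \<partial>lborel)"
    by (intro nn_integral_cong) (auto simp: indicator_def)
  finally show ?thesis .
qed

end

text \<open>
The law \<open>\<mu>\<close> tested in the infimum is the mixture of the averaged weights \<open>\<nu>\<close> with the uniform law, and
\<open>p\<close> has the weights \<open>w\<close> of a single round. Replacing the mixture by \<open>p\<close> adds at most \<open>1 + ln 2 \<le> 4\<close> to the
logarithm, hence at most 2 to its square root and \<open>2 D\<close> to the integral; the third \<open>D\<close> is the
error allowed in the game.
\<close>

lemma exists_entropic_law:
  assumes finT: "finite T" "T \<noteq> {}" and diam: "diam T (euc_dist N) = D" "D > 0"
  obtains p where "set_pmf p \<subseteq> T" "fernique_talagrand T (euc_dist N) \<le> ennreal (3 * D) +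
    (\<Sum>t\<in>set_pmf p. ennreal (pmf p t) * (\<integral>\<^sup>+ r\<in>{0..D}. ennreal (sqrt (ln (1 / ball_mass N p t r))) \<partial>lborel))"
proof -
  let ?d = "euc_dist N" 
  interpret finite_dist T ?d D using finT diam by unfold_locales auto
  let ?K = "half_entropy T ?d D"
  have "\<exists>w \<nu>. prob_weights T w \<and> prob_weights T \<nu> \<and> (\<forall>t\<in>T. ?K \<nu> t \<le> (\<Sum>u\<in>T. w u * ?K w u) + D)"
  proof (rule self_play[OF finT, where B = "D * sqrt (1 + ln (2 * card T))"])
    show "0 \<le> ?K w t \<and> ?K w t \<le> D * sqrt (1 + ln (2 * card T))" if "prob_weights T w" "t \<in> T" for w t
      using half_entropy_nonneg[OF that] half_entropy_le[OF that] by simp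
  qed (rule half_entropy_convex diam(2); assumption)+
  then obtain w \<nu> where w: "prob_weights T w" and \<nu>: "prob_weights T \<nu>"
    and K: "\<And>t. t \<in> T \<Longrightarrow> ?K \<nu> t \<le> (\<Sum>u\<in>T. w u * ?K w u) + D"
    by blast
  have card: "card T > 0" using finT by (simp add: card_gt_0_iff)
  have mix: "prob_weights T (\<lambda>u. (\<nu> u + 1 / card T) / 2)"
    using \<nu> card by (auto simp: prob_weights_def sum_divide_distrib[symmetric] sum.distrib)
  obtain \<mu> where \<mu>: "set_pmf \<mu> \<subseteq> T" "\<And>u. u \<in> T \<Longrightarrow> pmf \<mu> u = (\<nu> u + 1 / card T) / 2"
    using pmf_of_weights[OF finT(1) mix] by blast
  obtain p where p: "set_pmf p \<subseteq> T" "\<And>u. u \<in> T \<Longrightarrow> pmf p u = w u"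
    using pmf_of_weights[OF finT(1) w] by blast
  have pos: "half_mass T ?d v t r > 0" if "prob_weights T v" "t \<in> T" "r \<ge> 0" for v t r
  proof -
    have "0 < 1 / (2 * real (card T))" using card by simp
    also have "\<dots> \<le> half_mass T ?d v t r" using half_mass_bounds(2)[OF finT(1), of t v ?d r] that by simp
    finally show ?thesis .
  qed
  have "fernique_talagrand T ?d \<le>
      (SUP t\<in>T. \<integral>\<^sup>+ r\<in>{0..D}. sqrt_log_inv (measure_pmf.prob \<mu> (closed_ball T ?d t r)) \<partial>lborel)"
    unfolding fernique_talagrand_def diam(1) using \<mu>(1) by (intro INF_lower) (simp add: prob_on_def)
  also have "\<dots> \<le> ennreal ((\<Sum>u\<in>T. w u * ?K w u) + D)"
  proof (rule SUP_least)
    fix t assume t: "t \<in> T"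
    have "sqrt_log_inv (measure_pmf.prob \<mu> (closed_ball T ?d t r)) \<le> ennreal (sqrt (1 - ln (half_mass T ?d \<nu> t r)))"
      if "r \<ge> 0" for r
    proof -
      have "measure_pmf.prob \<mu> (closed_ball T ?d t r) = (\<Sum>u | u \<in> T \<and> ?d t u \<le> r. pmf \<mu> u)"
        using finT by (simp add: closed_ball_def measure_measure_pmf_finite)
      also have "\<dots> = half_mass T ?d \<nu> t r"
        unfolding half_mass_def sum.inter_filter[OF finT(1)]
        by (intro sum.cong) (auto simp: indicator_def \<mu>)
      finally show ?thesis
        using pos[OF \<nu> t that] by (auto simp: sqrt_log_inv_def ln_div intro!: ennreal_leI)
    qed
    then have "(\<integral>\<^sup>+ r\<in>{0..D}. sqrt_log_inv (measure_pmf.prob \<mu> (closed_ball T ?d t r)) \<partial>lborel) \<le>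
        (\<integral>\<^sup>+ r\<in>{0..D}. ennreal (sqrt (1 - ln (half_mass T ?d \<nu> t r))) \<partial>lborel)"
      by (intro nn_integral_mono) (auto simp: indicator_def)
    also have "\<dots> = ennreal (?K \<nu> t)" by (rule nn_half_entropy[OF \<nu> t, symmetric])
    also have "\<dots> \<le> ennreal ((\<Sum>u\<in>T. w u * ?K w u) + D)" using K[OF t] by (rule ennreal_leI)
    finally show "(\<integral>\<^sup>+ r\<in>{0..D}. sqrt_log_inv (measure_pmf.prob \<mu> (closed_ball T ?d t r)) \<partial>lborel) \<le>
      ennreal ((\<Sum>u\<in>T. w u * ?K w u) + D)" .
  qed
  also have "(\<Sum>u\<in>T. w u * ?K w u) = (\<Sum>u\<in>set_pmf p. pmf p u * ?K w u)"
    using finT(1) p by (intro sum.mono_neutral_cong_right) (auto simp: set_pmf_iff)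
  also have "ennreal ((\<Sum>u\<in>set_pmf p. pmf p u * ?K w u) + D) =
      (\<Sum>u\<in>set_pmf p. ennreal (pmf p u) * ennreal (?K w u)) + ennreal D"
    using p(1) half_entropy_nonneg[OF w] diam(2)
    by (subst ennreal_plus) (auto intro!: sum_nonneg simp: subset_iff ennreal_mult simp flip: sum_ennreal)
  also have "\<dots> \<le> (\<Sum>u\<in>set_pmf p. ennreal (pmf p u) * (ennreal (2 * D) +
      (\<integral>\<^sup>+ r\<in>{0..D}. ennreal (sqrt (ln (1 / ball_mass N p u r))) \<partial>lborel))) + ennreal D"
  proof (intro add_right_mono sum_mono mult_left_mono)
    fix t assume tp: "t \<in> set_pmf p"
    then have t: "t \<in> T" using p by auto
    have "sqrt (1 - ln (half_mass T ?d w t r)) \<le> 2 + sqrt (ln (1 / ball_mass N p t r))" if "r \<ge> 0" for r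
    proof -
      have "ball_mass N p t r = measure_pmf.prob p {u. u \<in> T \<and> ?d t u \<le> r}"
        unfolding ball_mass_def using p(1)
        by (intro measure_pmf.finite_measure_eq_AE) (auto simp: AE_measure_pmf_iff)
      also have "\<dots> = (\<Sum>u | u \<in> T \<and> ?d t u \<le> r. w u)"
        using finT p by (simp add: measure_measure_pmf_finite)
      finally have half: "ball_mass N p t r / 2 \<le> half_mass T ?d w t r"
        using half_mass_bounds(3)[OF finT(1) t w, of ?d r] that by simp
      have b: "ball_mass N p t r > 0" using ball_mass_pos[OF tp that] .
      have "ln (ball_mass N p t r / 2) \<le> ln (half_mass T ?d w t r)"
        using b half by (intro ln_mono) auto
      then have "1 - ln (half_mass T ?d w t r) \<le> 4 + ln (1 / ball_mass N p t r)"
        using b ln_le_minus_one[of 2] by (simp add: ln_div)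
      then have "sqrt (1 - ln (half_mass T ?d w t r)) \<le> sqrt (4 + ln (1 / ball_mass N p t r))" by simp
      also have "\<dots> \<le> sqrt 4 + sqrt (ln (1 / ball_mass N p t r))"
        using b ball_mass_le_1[of N p t r] by (intro sqrt_add_le_add_sqrt ln_ge_zero) auto
      finally show ?thesis by simp
    qed
    then have "ennreal (sqrt (1 - ln (half_mass T ?d w t r))) * indicator {0..D} r \<le>
        2 * indicator {0..D} r + ennreal (sqrt (ln (1 / ball_mass N p t r))) * indicator {0..D} r" for r
      using ball_mass_pos[OF tp] ball_mass_le_1[of N p t]
      by (cases "r \<in> {0..D}") (auto simp flip: ennreal_plus ennreal_numeral intro!: ennreal_leI)
    then have "ennreal (?K w t) \<le> (\<integral>\<^sup>+ r. 2 * indicator {0..D} r +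
        ennreal (sqrt (ln (1 / ball_mass N p t r))) * indicator {0..D} r \<partial>lborel)"
      unfolding nn_half_entropy[OF w t] by (rule nn_integral_mono)
    also have "\<dots> = ennreal (2 * D) + (\<integral>\<^sup>+ r\<in>{0..D}. ennreal (sqrt (ln (1 / ball_mass N p t r))) \<partial>lborel)"
      using diam(2) by (subst nn_integral_add) (auto simp: nn_integral_cmult_indicator ennreal_mult)
    finally show "ennreal (?K w t) \<le> \<dots>" .
  qed simp
  also have "\<dots> = ennreal (3 * D) +
    (\<Sum>t\<in>set_pmf p. ennreal (pmf p t) * (\<integral>\<^sup>+ r\<in>{0..D}. ennreal (sqrt (ln (1 / ball_mass N p t r))) \<partial>lborel))"
  proof -
    have "(\<Sum>u\<in>set_pmf p. ennreal (pmf p u)) = 1"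
      using sum_pmf_eq_1[of "set_pmf p" p] finite_subset[OF p(1) finT(1)] by simp
    moreover have "ennreal (2 * D) + ennreal D = ennreal (3 * D)"
      using diam(2) by (simp flip: ennreal_plus)
    ultimately show ?thesis
      by (simp add: distrib_left sum.distrib sum_distrib_right[symmetric] ac_simps)
  qed
  finally show thesis by (intro that[OF p(1)])
qed

section \<open>Comparison of the two functionals\<close>

text \<open>
For \<open>s \<le> 1 / D\<close> two points at distance \<open>D\<close> cannot be told apart reliably, since then
\<open>exp (2 s\<^sup>2 D\<^sup>2) \<le> exp 2 \<le> 9\<close>.
\<close>

lemma MMSE_two_point:
  assumes xy: "x \<noteq> y" and d: "euc_dist N x y = D" "D > 0"
  shows "ennreal (D / 20) \<le> (\<integral>\<^sup>+ s\<in>{0..}. MMSE N (pmf_of_set {x, y}) s \<partial>lborel)"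
proof -
  define p where "p = pmf_of_set {x, y}"
  have p: "set_pmf p = {x, y}" "pmf p x = 1 / 2" "pmf p y = 1 / 2"
    using xy by (auto simp: p_def)
  have d': "euc_dist N y x = D"
    using d(1) by (simp add: euc_dist_def L2_set_def power2_commute)
  have "ennreal (D\<^sup>2 / 20) \<le> MMSE N p s" if s: "s \<in> {0..1 / D}" for s
  proof -
    have "(s * D)\<^sup>2 \<le> 1\<^sup>2" using s d(2) by (intro power_mono) (auto simp: field_simps)
    then have "exp (2 * s\<^sup>2 * D\<^sup>2) \<le> exp 2" by (simp add: power_mult_distrib)
    also have "exp (2::real) = (exp 1)\<^sup>2" by (simp add: exp_of_nat_mult[symmetric] power2_eq_square exp_add[symmetric])
    also have "\<dots> \<le> 3\<^sup>2" using exp_le by (intro power_mono) auto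
    finally have e: "exp (2 * s\<^sup>2 * D\<^sup>2) \<le> 9" by simp
    have "ennreal (D\<^sup>2 / (1 + 9)) \<le> local_risk N p s x"
      by (rule local_risk_ge[where A = "{x}" and B = "{y}" and R = D]) (use d xy e in \<open>auto simp: p\<close>)
    moreover have "ennreal (D\<^sup>2 / (1 + 9)) \<le> local_risk N p s y"
      by (rule local_risk_ge[where A = "{y}" and B = "{x}" and R = D]) (use d d' xy e in \<open>auto simp: p\<close>)
    ultimately have "(\<Sum>u\<in>set_pmf p. ennreal (pmf p u) * ennreal (D\<^sup>2 / 10)) / 2
        \<le> (\<Sum>u\<in>set_pmf p. ennreal (pmf p u) * local_risk N p s u) / 2"
      by (intro divide_right_mono_ennreal sum_mono mult_left_mono) (auto simp: p)
    also have "\<dots> \<le> MMSE N p s" by (rule MMSE_ge_local_risk) (simp add: p)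
    also have "(\<Sum>u\<in>set_pmf p. ennreal (pmf p u) * ennreal (D\<^sup>2 / 10)) / 2 = ennreal (D\<^sup>2 / 20)"
      using xy by (simp add: p ennreal_mult[symmetric] flip: ennreal_plus) (subst ennreal_numeral[symmetric], subst divide_ennreal, auto)
    finally show ?thesis .
  qed
  then have "(\<integral>\<^sup>+ s\<in>{0..1 / D}. ennreal (D\<^sup>2 / 20) \<partial>lborel) \<le> (\<integral>\<^sup>+ s\<in>{0..}. MMSE N p s \<partial>lborel)"
    using d(2) by (intro nn_integral_mono) (auto simp: indicator_def)
  moreover have "(\<integral>\<^sup>+ s\<in>{0..1 / D}. ennreal (D\<^sup>2 / 20) \<partial>lborel) = ennreal (D / 20)"
    using d(2) by (simp add: nn_integral_cmult_indicator ennreal_mult[symmetric] power2_eq_square)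
  ultimately show ?thesis by (simp add: p_def)
qed

theorem mainTheorem2:
  "\<exists>c::real. c > 0 \<and>
     (\<forall>(N::nat) (T::(nat \<Rightarrow> real) set). N \<ge> 1 \<and> finite T \<and> T \<noteq> {} \<and> T \<subseteq> RN N \<longrightarrow>
        ennreal c * fernique_talagrand T (euc_dist N) \<le> integrated_bayes_risk N T)"
proof (intro exI conjI allI impI)
  show "1 / 112 > (0::real)" by simp
  fix N :: nat and T :: "(nat \<Rightarrow> real) set"
  assume "N \<ge> 1 \<and> finite T \<and> T \<noteq> {} \<and> T \<subseteq> RN N"
  then have fin: "finite T" "T \<noteq> {}" by auto
  let ?d = "euc_dist N" and ?Z = "integrated_bayes_risk N T"
  define D where "D = diam T ?d"
  define dists where "dists = {?d x y | x y. x \<in> T \<and> y \<in> T}"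
  have dists: "finite dists" "dists \<noteq> {}"
    using fin finite_image_set2[of "\<lambda>x. x \<in> T" "\<lambda>x. x \<in> T" ?d] by (auto simp: dists_def)
  have D_ge: "?d x y \<le> D" if "x \<in> T" "y \<in> T" for x y
    unfolding D_def diam_def dists_def[symmetric] using dists that by (intro Max_ge) (auto simp: dists_def)
  obtain x y where xy: "x \<in> T" "y \<in> T" "?d x y = D"
    using Max_in[OF dists] unfolding D_def diam_def dists_def[symmetric] by (auto simp: dists_def)
  have risk_le: "(\<integral>\<^sup>+ s\<in>{0..}. MMSE N p s \<partial>lborel) \<le> ?Z" if "set_pmf p \<subseteq> T" for p
    unfolding integrated_bayes_risk_def using that by (intro SUP_upper) (simp add: prob_on_def)
  have "D \<ge> 0" using D_ge[OF xy(1) xy(1)] by simp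
  then consider "D = 0" | "D > 0" by linarith
  then show "ennreal (1 / 112) * fernique_talagrand T ?d \<le> ?Z"
  proof cases
    case 1
    have "fernique_talagrand T ?d \<le>
        (SUP t\<in>T. \<integral>\<^sup>+ r\<in>{0..D}. sqrt_log_inv (measure_pmf.prob (return_pmf x) (closed_ball T ?d t r)) \<partial>lborel)"
      unfolding fernique_talagrand_def D_def[symmetric] using xy by (intro INF_lower) (simp add: prob_on_def)
    also have "\<dots> = 0"
    proof -
      have "(\<integral>\<^sup>+ r\<in>{0..D}. f r \<partial>lborel) = 0" for f :: "real \<Rightarrow> ennreal"
      proof -
        have "(\<integral>\<^sup>+ r\<in>{0..D}. f r \<partial>lborel) = (\<integral>\<^sup>+ r. 0 \<partial>(lborel :: real measure))"
          using AE_lborel_singleton[of "0::real"] by (intro nn_integral_cong_AE) (auto simp: 1 indicator_def)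
        then show ?thesis by simp
      qed
      then show ?thesis using fin by simp
    qed
    finally show ?thesis by simp
  next
    case 2
    have ne: "x \<noteq> y" using xy 2 by auto
    have "ennreal (D / 20) \<le> ?Z"
      using MMSE_two_point[OF ne xy(3) 2] risk_le[of "pmf_of_set {x, y}"] xy by (auto intro: order.trans)
    then have "ennreal 100 * ennreal (D / 20) \<le> 100 * ?Z" by (simp add: mult_left_mono)
    then have diam_le: "ennreal (5 * D) \<le> 100 * ?Z"
      using 2 by (simp flip: ennreal_mult ennreal_numeral)
    obtain p where p: "set_pmf p \<subseteq> T" and le: "fernique_talagrand T ?d \<le> ennreal (3 * D) +
      (\<Sum>t\<in>set_pmf p. ennreal (pmf p t) * (\<integral>\<^sup>+ r\<in>{0..D}. ennreal (sqrt (ln (1 / ball_mass N p t r))) \<partial>lborel))"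
      by (rule exists_entropic_law[OF fin D_def[symmetric] 2])
    have finp: "finite (set_pmf p)" using finite_subset[OF p fin(1)] .
    have psum: "(\<Sum>u\<in>set_pmf p. ennreal (pmf p u)) = 1"
      using sum_pmf_eq_1[of "set_pmf p" p] finp by simp
    note le
    also have "ennreal (3 * D) +
        (\<Sum>t\<in>set_pmf p. ennreal (pmf p t) * (\<integral>\<^sup>+ r\<in>{0..D}. ennreal (sqrt (ln (1 / ball_mass N p t r))) \<partial>lborel)) \<le>
      ennreal (3 * D) + (\<Sum>t\<in>set_pmf p. ennreal (pmf p t) *
        (ennreal (2 * D) + 6 * (\<integral>\<^sup>+ s\<in>{0..}. local_risk N p s t \<partial>lborel)))"
    proof (intro add_left_mono sum_mono mult_left_mono entropy_integral_le_local_risk finp 2)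
      fix t assume "t \<in> set_pmf p"
      then show "ball_mass N p t D = 1"
        unfolding ball_mass_def using p D_ge by (auto simp: measure_pmf.prob_eq_1 AE_measure_pmf_iff)
    qed auto
    also have "\<dots> = ennreal (5 * D) + 12 * (\<integral>\<^sup>+ s\<in>{0..}.
        ((\<Sum>t\<in>set_pmf p. ennreal (pmf p t) * local_risk N p s t) / 2) \<partial>lborel)"
    proof -
      have "(\<integral>\<^sup>+ s\<in>{0..}. ((\<Sum>t\<in>set_pmf p. ennreal (pmf p t) * local_risk N p s t) / 2) \<partial>lborel) =
          (\<integral>\<^sup>+ s. (\<Sum>t\<in>set_pmf p. ennreal (pmf p t) * (local_risk N p s t * indicator {0..} s)) / 2 \<partial>lborel)"
        by (intro nn_integral_cong) (auto simp: indicator_def)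
      also have "\<dots> = (\<Sum>t\<in>set_pmf p. ennreal (pmf p t) * (\<integral>\<^sup>+ s\<in>{0..}. local_risk N p s t \<partial>lborel)) / 2"
        by (simp add: nn_integral_divide nn_integral_sum nn_integral_cmult)
      finally have "12 * (\<integral>\<^sup>+ s\<in>{0..}. ((\<Sum>t\<in>set_pmf p. ennreal (pmf p t) * local_risk N p s t) / 2) \<partial>lborel) =
          6 * (2 * ((\<Sum>t\<in>set_pmf p. ennreal (pmf p t) * (\<integral>\<^sup>+ s\<in>{0..}. local_risk N p s t \<partial>lborel)) / 2))"
        by (simp add: mult.assoc[symmetric])
      also have "\<dots> = (\<Sum>t\<in>set_pmf p. ennreal (pmf p t) * (6 * (\<integral>\<^sup>+ s\<in>{0..}. local_risk N p s t \<partial>lborel)))"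
      proof -
        have "2 * (a / 2) = a" for a :: ennreal
          by (simp add: ennreal_times_divide mult.commute[of 2] ennreal_mult_divide_eq)
        then show ?thesis by (simp add: sum_distrib_left mult.left_commute)
      qed
      finally have *: "(\<Sum>t\<in>set_pmf p. ennreal (pmf p t) * (6 * (\<integral>\<^sup>+ s\<in>{0..}. local_risk N p s t \<partial>lborel))) =
        12 * (\<integral>\<^sup>+ s\<in>{0..}. ((\<Sum>t\<in>set_pmf p. ennreal (pmf p t) * local_risk N p s t) / 2) \<partial>lborel)" ..
      have "ennreal (3 * D) + ennreal (2 * D) = ennreal (5 * D)" using 2 by (simp flip: ennreal_plus)
      then show ?thesis
        by (simp add: distrib_left sum.distrib sum_distrib_right[symmetric] psum * add.assoc[symmetric])
    qed
    also have "\<dots> \<le> 100 * ?Z + 12 * (\<integral>\<^sup>+ s\<in>{0..}. MMSE N p s \<partial>lborel)"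
      by (intro add_mono diam_le mult_left_mono nn_integral_mono mult_right_mono MMSE_ge_local_risk finp) auto
    also have "\<dots> \<le> 100 * ?Z + 12 * ?Z" by (intro add_left_mono mult_left_mono risk_le p) auto
    also have "\<dots> = 112 * ?Z" by (simp flip: distrib_right)
    finally have "ennreal (1 / 112) * fernique_talagrand T ?d \<le> ennreal (1 / 112) * (112 * ?Z)"
      by (intro mult_left_mono) auto
    also have "\<dots> = ennreal (1 / 112 * 112) * ?Z" by (subst ennreal_mult) (auto simp: mult.assoc)
    finally show ?thesis by simp
  qed
qed

end
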